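(* Let $\rho,\kappa,\delta>0$ and $0<\alpha<1$, and let $$\omega(\xi)=\left(\frac{2\kappa}{\rho\,\delta^{2\alpha}}\int_{-1}^{1}\frac{1-\cos(\xi\delta z)}{|z|^{1+2\alpha}}\,dz\right)^{1/2},\qquad I_\alpha:=\int_0^{+\infty}\frac{1-\cos\tau}{\tau^{1+2\alpha}}\,d\tau.$$ Then, with $\omega',\omega''$ the derivatives of $\omega$ on $\mathbb R\setminus\{0\}$: (1) $\displaystyle\lim_{\xi\to0^\pm}\omega'(\xi)=\pm\frac{\sqrt\kappa\,\delta^{1-\alpha}}{\sqrt{(1-\alpha)\rho}}$; (2) $\displaystyle\lim_{\xi\to\pm\infty}|\xi|^{1-\alpha}\omega'(\xi)=\pm2\alpha\sqrt{\frac{\kappa}{\rho}\,I_\alpha}$; (3) $\displaystyle\lim_{\xi\to0^\pm}|\xi|^{-1}\omega''(\xi)=-\frac{\sqrt{\kappa(1-\alpha)}\;\delta^{3-\alpha}}{4(2-\alpha)\sqrt\rho}$; (4) $\displaystyle\lim_{\xi\to0^\pm}\omega''(\xi)=0$; (5) if $\alpha\in\left(\frac12,1\right)$, then $\displaystyle\lim_{\xi\to\pm\infty}|\xi|^{2-\alpha}\omega''(\xi)=-\frac{2\alpha(1-\alpha)\sqrt\kappa}{\sqrt\rho}\,I_\alpha^{1/2}$; (6) if $\alpha\in\left(0,\frac12\right)$, then $$\liminf_{\xi\to\pm\infty}|\xi|^{1+\alpha}\omega''(\xi)=-\frac{\sqrt\kappa\,\delta^{1-2\alpha}}{\sqrt\rho}\,I_\alpha^{-1/2}<\frac{\sqrt\kappa\,\delta^{1-2\alpha}}{\sqrt\rho}\,I_\alpha^{-1/2}=\limsup_{\xi\to\pm\infty}|\xi|^{1+\alpha}\omega''(\xi);$$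 (7) if $\alpha=\frac12$, then $$\liminf_{\xi\to\pm\infty}|\xi|^{3/2}\omega''(\xi)=-\frac{\sqrt\kappa}{\sqrt\rho}\,I_{1/2}^{-1/2}-\frac12\left(\frac\kappa\rho\,I_{1/2}\right)^{1/2}<\frac{\sqrt\kappa}{\sqrt\rho}\,I_{1/2}^{-1/2}-\frac12\left(\frac\kappa\rho\,I_{1/2}\right)^{1/2}=\limsup_{\xi\to\pm\infty}|\xi|^{3/2}\omega''(\xi).$$
   Context: Each statement with $\xi\to\pm\infty$ (or $\xi\to0^\pm$) is understood separately for $\xi\to+\infty$ and for $\xi\to-\infty$ (respectively $\xi\to0^+$ and $\xi\to0^-$), with the corresponding sign. *)

theory Defs
  imports "HOL-Analysis.Analysis"
begin

text \<open>The value of the integrand at \<open>z = 0\<close>, which is \<open>0\<close> by the convention \<open>x / 0 = 0\<close>,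
  does not affect the integral. The integrands of \<open>omega\<close> and \<open>I_const\<close> are nonnegative, so
  the Henstock-Kurzweil integral used here agrees with the Lebesgue integral.\<close>

definition omega :: "real \<Rightarrow> real \<Rightarrow> real \<Rightarrow> real \<Rightarrow> real \<Rightarrow> real" where
  "omega \<rho> \<kappa> \<delta> \<alpha> \<xi> =
     sqrt (2 * \<kappa> / (\<rho> * \<delta> powr (2 * \<alpha>)) *
       integral {-1..1} (\<lambda>z. (1 - cos (\<xi> * \<delta> * z)) / \<bar>z\<bar> powr (1 + 2 * \<alpha>)))"

definition I_const :: "real \<Rightarrow> real" where
  "I_const \<alpha> = integral {0<..} (\<lambda>\<tau>. (1 - cos \<tau>) / \<tau> powr (1 + 2 * \<alpha>))"

end

theory Submission
  imports Defs "HOL-Real_Asymp.Real_Asymp"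
begin

text \<open>Substituting \<open>\<tau> = \<xi> \<delta> z\<close> in the defining integral turns \<open>\<omega>\<close> into a one-variable object. With
  \<open>J x = \<integral>\<^sub>0\<^sup>x (1 - cos \<tau>) / \<tau> powr (1 + 2 * \<alpha>) d\<tau>\<close> (the function \<^term>\<open>partial_I\<close> below) and
  \<open>g x = sqrt (x powr (2 * \<alpha>) * J x)\<close>, the dispersion relation is
  \<open>\<omega> \<xi> = 2 * sqrt (\<kappa> / \<rho>) * \<delta> powr (- \<alpha>) * g (\<delta> * \<bar>\<xi>\<bar>)\<close>. So all parameters but \<open>\<alpha>\<close> are
  removed by scaling, and evenness makes the statements for \<open>\<xi> < 0\<close> mirror images of those for
  \<open>\<xi> > 0\<close>. The derivative \<open>J' x = (1 - cos x) / x powr (1 + 2 * \<alpha>)\<close> is elementary, so \<open>g'\<close> and \<open>g''\<close>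
  are explicit expressions in \<open>x\<close> and \<open>J x\<close>, and only the behaviour of \<open>J\<close> at the two ends is needed.

  At \<open>0\<close>, l'Hopital's rule gives
  \<open>J x / x powr (2 - 2 * \<alpha>) = 1 / (4 * (1 - \<alpha>)) - x\<^sup>2 / (48 * (2 - \<alpha>)) + o(x\<^sup>2)\<close>
  (lemma \<open>scaled_I_expansion\<close>). The leading term makes \<open>g\<close> asymptotically linear, which is the limit
  of \<open>\<omega>'\<close>. In \<open>g''\<close> the leading terms cancel, and the terms of order \<open>x\<^sup>2\<close> give the limit of
  \<open>g'' x / x\<close>.

  At infinity, \<open>J x\<close> tends to \<^term>\<open>I_const\<close>, with an error at most \<open>x powr (- 2 * \<alpha>) / \<alpha>\<close>. Then
  \<open>x powr (2 - \<alpha>) * g'' x\<close> is the sum of a convergent part with limit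
  \<open>- \<alpha> * (1 - \<alpha>) * sqrt (I_const \<alpha>)\<close> and the oscillation
  \<open>sin x * x powr (1 - 2 * \<alpha>) / (2 * sqrt (J x))\<close>, which comes from differentiating the upper endpoint
  of the integral twice (lemma \<open>profile2_decomposition\<close>). For \<open>\<alpha> > 1 / 2\<close> the oscillation dies out, for
  \<open>\<alpha> < 1 / 2\<close> it dominates, and for \<open>\<alpha> = 1 / 2\<close> both parts have the same order. In the last two cases
  the lower and upper limits are those of \<open>b + c * sin (\<delta> * \<bar>\<xi>\<bar>)\<close>, that is, \<open>b - c\<close> and \<open>b + c\<close>.\<close>

section \<open>The partial integrals of \<open>I_const\<close>\<close>


definition kern :: "real \<Rightarrow> real \<Rightarrow> real" where
  "kern \<alpha> t = (1 - cos t) / t powr (1 + 2 * \<alpha>)"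

definition partial_I :: "real \<Rightarrow> real \<Rightarrow> real" where
  "partial_I \<alpha> x = integral {0..x} (kern \<alpha>)"

lemma one_minus_cos_le: "1 - cos t \<le> t\<^sup>2 / 2" for t :: real
proof -
  have "\<bar>sin (t / 2)\<bar> \<le> \<bar>t / 2\<bar>"
    by (rule abs_sin_x_le_abs_x)
  then have "(sin (t / 2))\<^sup>2 \<le> (t / 2)\<^sup>2"
    by (rule abs_le_square_iff[THEN iffD1])
  moreover have "cos t = 1 - 2 * (sin (t / 2))\<^sup>2"
    using cos_double_sin[of "t / 2"] by simp
  ultimately show ?thesis
    by (simp add: power_divide)
qed

lemma kern_nonneg: "0 \<le> kern \<alpha> t"
  by (simp add: kern_def)

lemma kern_le_near_0:
  assumes "0 \<le> t"
  shows "kern \<alpha> t \<le> t powr (1 - 2 * \<alpha>) / 2"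
proof (cases "t = 0")
  case True
  then show ?thesis by (simp add: kern_def)
next
  case False
  with assms have t: "0 < t" by simp
  have "kern \<alpha> t \<le> (t\<^sup>2 / 2) / t powr (1 + 2 * \<alpha>)"
    unfolding kern_def by (intro divide_right_mono one_minus_cos_le) simp
  also have "\<dots> = t powr (2 - (1 + 2 * \<alpha>)) / 2"
    using t by (subst powr_diff) (simp add: powr_numeral)
  finally show ?thesis by simp
qed

lemma kern_le_tail:
  assumes "0 < t"
  shows "kern \<alpha> t \<le> 2 * t powr (- 1 - 2 * \<alpha>)"
proof -
  have "kern \<alpha> t \<le> 2 / t powr (1 + 2 * \<alpha>)"
    unfolding kern_def using cos_ge_minus_one[of t] by (intro divide_right_mono) auto
  also have "\<dots> = 2 * t powr (- (1 + 2 * \<alpha>))"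
    by (subst powr_minus_divide) simp
  finally show ?thesis by simp
qed

lemma kern_measurable: "kern \<alpha> \<in> borel_measurable (lebesgue_on S)"
proof -
  have "kern \<alpha> \<in> borel_measurable borel"
    unfolding kern_def[abs_def] by measurable
  then show ?thesis
    by (simp add: measurable_completion measurable_restrict_space1)
qed

lemma kern_integrable_Icc:
  assumes "\<alpha> < 1" "0 \<le> x"
  shows "kern \<alpha> integrable_on {0..x}"
proof (rule measurable_bounded_by_integrable_imp_integrable[OF kern_measurable])
  show "(\<lambda>t. t powr (1 - 2 * \<alpha>) / 2) integrable_on {0..x}"
    using has_integral_powr_from_0[of "1 - 2 * \<alpha>" x] assms
    by (intro integrable_on_divide) (auto simp: integrable_on_def)
qed (use kern_nonneg kern_le_near_0 in auto)

lemma kern_integrable_Ici: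
  assumes "0 < \<alpha>" "0 < x"
  shows "kern \<alpha> integrable_on {x..}"
proof (rule measurable_bounded_by_integrable_imp_integrable[OF kern_measurable])
  show "(\<lambda>t. 2 * t powr (- 1 - 2 * \<alpha>)) integrable_on {x..}"
    using has_integral_powr_to_inf[of "- 1 - 2 * \<alpha>" x] assms
    by (intro integrable_on_mult_right) (auto simp: integrable_on_def)
qed (use kern_nonneg kern_le_tail assms in auto)

lemma partial_I_nonneg:
  assumes "\<alpha> < 1" "0 \<le> x"
  shows "0 \<le> partial_I \<alpha> x"
  unfolding partial_I_def
  using assms by (intro integral_nonneg kern_integrable_Icc kern_nonneg)

lemma partial_I_mono:
  assumes "\<alpha> < 1" "0 \<le> x" "x \<le> y"
  shows "partial_I \<alpha> x \<le> partial_I \<alpha> y"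
  unfolding partial_I_def using assms
  by (intro integral_subset_le kern_integrable_Icc) (auto simp: kern_nonneg)

lemma partial_I_has_derivative:
  assumes "\<alpha> < 1" "0 < x"
  shows "(partial_I \<alpha> has_real_derivative kern \<alpha> x) (at x)"
proof -
  have "isCont (kern \<alpha>) x"
    unfolding kern_def[abs_def] using assms by (intro continuous_intros) auto
  then have "continuous (at x within ({0..x + 1} - {})) (kern \<alpha>)"
    by (rule continuous_at_imp_continuous_at_within)
  then have "((\<lambda>u. integral {0..u} (kern \<alpha>)) has_vector_derivative kern \<alpha> x)
      (at x within ({0..x + 1} - {}))"
    using assms kern_integrable_Icc[of \<alpha> "x + 1"]
    by (intro integral_has_vector_derivative_continuous_at) auto
  moreover have "at x within ({0..x + 1} - {}) = at x"
    using assms by (intro at_within_interior) (auto simp: interior_atLeastAtMost_real)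
  ultimately show ?thesis
    by (simp add: partial_I_def[abs_def] has_real_derivative_iff_has_vector_derivative)
qed

text \<open>The kernel vanishes at the multiples of \<open>2 * pi\<close>, so strict positivity is read off from the
  strict increase of the integral on an interval inside \<open>(0, 1]\<close>.\<close>

lemma partial_I_pos:
  assumes "\<alpha> < 1" "0 < x"
  shows "0 < partial_I \<alpha> x"
proof -
  \<comment> \<open>Up to \<open>1 < pi\<close> the cosine stays below \<open>1\<close>.\<close>
  define c where "c = min x 1"
  have c: "0 < c" "c \<le> 1" "c \<le> x"
    using assms by (auto simp: c_def)
  have "partial_I \<alpha> (c / 2) < partial_I \<alpha> c"
  proof (rule DERIV_pos_imp_increasing[where f = "partial_I \<alpha>"])
    fix t assume t: "c / 2 \<le> t" "t \<le> c"
    with c have "0 < t" "t < pi"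
      using pi_gt3 by linarith+
    then have "cos t < 1"
      using cos_monotone_0_pi[of 0 t] by simp
    then have "0 < kern \<alpha> t"
      using \<open>0 < t\<close> by (simp add: kern_def)
    then show "\<exists>y. (partial_I \<alpha> has_real_derivative y) (at t) \<and> 0 < y"
      using partial_I_has_derivative[OF assms(1) \<open>0 < t\<close>] by blast
  qed (use c in simp)
  moreover have "0 \<le> partial_I \<alpha> (c / 2)"
    using assms c by (intro partial_I_nonneg) auto
  moreover have "partial_I \<alpha> c \<le> partial_I \<alpha> x"
    using assms c by (intro partial_I_mono) auto
  ultimately show ?thesis by linarith
qed

lemma I_const_split:
  assumes "0 < \<alpha>" "\<alpha> < 1" "0 < x"
  shows "I_const \<alpha> = partial_I \<alpha> x + integral {x..} (kern \<alpha>)"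
proof -
  have "I_const \<alpha> = integral {0<..} (kern \<alpha>)"
    by (simp add: I_const_def kern_def[abs_def])
  also have "\<dots> = integral {0..} (kern \<alpha>)"
    by (rule integral_spike_set) (auto intro: negligible_subset[of "{0}"])
  also have "{0..} = {0..x} \<union> {x..}"
    using assms by auto
  also have "integral ({0..x} \<union> {x..}) (kern \<alpha>)
      = integral {0..x} (kern \<alpha>) + integral {x..} (kern \<alpha>)"
    using assms
    by (intro integral_Un kern_integrable_Icc kern_integrable_Ici)
       (auto intro: negligible_subset[of "{x}"])
  finally show ?thesis by (simp add: partial_I_def)
qed

text \<open>The remainder of the improper integral is compared with that of \<open>2 * t powr (- 1 - 2 * \<alpha>)\<close>.\<close>

lemma I_const_bounds:
  assumes "0 < \<alpha>" "\<alpha> < 1" "0 < x"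
  shows "partial_I \<alpha> x \<le> I_const \<alpha>" "I_const \<alpha> \<le> partial_I \<alpha> x + x powr (- 2 * \<alpha>) / \<alpha>"
proof -
  have int: "((\<lambda>t. 2 * t powr (- 1 - 2 * \<alpha>)) has_integral (x powr (- 2 * \<alpha>) / \<alpha>)) {x..}"
    using has_integral_mult_right[OF has_integral_powr_to_inf[of "- 1 - 2 * \<alpha>" x], of 2] assms
    by (simp add: field_simps)
  have "integral {x..} (kern \<alpha>) \<le> x powr (- 2 * \<alpha>) / \<alpha>"
    using assms int
    by (intro has_integral_le[OF integrable_integral[OF kern_integrable_Ici] int])
       (auto intro: kern_le_tail)
  moreover have "0 \<le> integral {x..} (kern \<alpha>)"
    using assms by (intro integral_nonneg kern_integrable_Ici kern_nonneg)
  ultimately show "partial_I \<alpha> x \<le> I_const \<alpha>"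
      "I_const \<alpha> \<le> partial_I \<alpha> x + x powr (- 2 * \<alpha>) / \<alpha>"
    using I_const_split[OF assms] by linarith+
qed

lemma I_const_pos:
  assumes "0 < \<alpha>" "\<alpha> < 1"
  shows "0 < I_const \<alpha>"
  using partial_I_pos[of \<alpha> 1] I_const_bounds(1)[of \<alpha> 1] assms by simp

lemma partial_I_tendsto:
  assumes "0 < \<alpha>" "\<alpha> < 1"
  shows "(partial_I \<alpha> \<longlongrightarrow> I_const \<alpha>) at_top"
proof (rule tendsto_sandwich)
  show "\<forall>\<^sub>F x in at_top. I_const \<alpha> - x powr (- 2 * \<alpha>) / \<alpha> \<le> partial_I \<alpha> x"
    using eventually_gt_at_top[of 0]
    by eventually_elim (use I_const_bounds(2)[OF assms] in \<open>simp add: algebra_simps\<close>)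
  show "\<forall>\<^sub>F x in at_top. partial_I \<alpha> x \<le> I_const \<alpha>"
    using eventually_gt_at_top[of 0] by eventually_elim (use I_const_bounds(1)[OF assms] in simp)
  show "((\<lambda>x. I_const \<alpha> - x powr (- 2 * \<alpha>) / \<alpha>) \<longlongrightarrow> I_const \<alpha>) at_top"
    using assms by real_asymp
qed simp

lemma partial_I_le:
  assumes "\<alpha> < 1" "0 \<le> x"
  shows "partial_I \<alpha> x \<le> x powr (2 - 2 * \<alpha>) / (2 * (2 - 2 * \<alpha>))"
proof -
  have "((\<lambda>t. t powr (1 - 2 * \<alpha>) / 2) has_integral (x powr (2 - 2 * \<alpha>) / (2 * (2 - 2 * \<alpha>)))) {0..x}"
    using has_integral_divide[OF has_integral_powr_from_0[of "1 - 2 * \<alpha>" x], of 2] assms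
    by (simp add: field_simps)
  then show ?thesis
    unfolding partial_I_def using assms
    by (intro has_integral_le[OF integrable_integral[OF kern_integrable_Icc]])
       (auto intro: kern_le_near_0)
qed

section \<open>Expansion of the partial integrals at zero\<close>

text \<open>Since \<open>kern \<alpha> t\<close> behaves like \<open>t powr (1 - 2 * \<alpha>) / 2\<close> near \<open>0\<close>, this is the normalisation of the
  partial integral which has a finite positive limit at \<open>0\<close>.\<close>

definition scaled_I :: "real \<Rightarrow> real \<Rightarrow> real" where
  "scaled_I \<alpha> x = partial_I \<alpha> x / x powr (2 - 2 * \<alpha>)"

text \<open>After clearing denominators this is a \<open>0 / 0\<close> limit for
  \<open>J x - x powr p / (2 * p)\<close> over \<open>x powr (p + 2)\<close> with \<open>p = 2 - 2 * \<alpha>\<close>. One application of l'Hopital's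
  rule eliminates the integral and leaves the Taylor coefficient \<open>- 1 / 24\<close> of
  \<open>1 - cos x - x\<^sup>2 / 2\<close>.\<close>

lemma scaled_I_expansion:
  assumes "0 < \<alpha>" "\<alpha> < 1"
  shows "((\<lambda>x. (scaled_I \<alpha> x - 1 / (4 * (1 - \<alpha>))) / x\<^sup>2) \<longlongrightarrow> - 1 / (48 * (2 - \<alpha>))) (at_right 0)"
proof -
  define p where "p = 2 - 2 * \<alpha>"
  have p: "0 < p" "p < 2" "1 + 2 * \<alpha> = 3 - p"
    using assms by (auto simp: p_def)
  let ?f = "\<lambda>x. partial_I \<alpha> x - x powr p / (2 * p)"
  have "((\<lambda>x. ?f x / x powr (p + 2)) \<longlongrightarrow> - 1 / (24 * (p + 2))) (at_right 0)"
  proof (rule lhopital_right_0)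
    show "(?f \<longlongrightarrow> 0) (at_right 0)"
    proof (rule tendsto_sandwich)
      show "\<forall>\<^sub>F x in at_right 0. - (x powr p / (2 * p)) \<le> ?f x"
        using eventually_at_right_less[of 0]
        by eventually_elim (use partial_I_nonneg[of \<alpha>] assms in simp)
      show "\<forall>\<^sub>F x in at_right 0. ?f x \<le> 0"
        using eventually_at_right_less[of 0]
        by eventually_elim (use partial_I_le[of \<alpha>] assms in \<open>simp add: p_def\<close>)
      show "((\<lambda>x. - (x powr p / (2 * p))) \<longlongrightarrow> 0) (at_right 0)"
        using p by real_asymp
    qed simp
    show "((\<lambda>x. x powr (p + 2)) \<longlongrightarrow> 0) (at_right 0)"
      using p by real_asymp
    show "\<forall>\<^sub>F x in at_right 0. x powr (p + 2) \<noteq> 0"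
      using eventually_at_right_less[of 0] by eventually_elim simp
    show "\<forall>\<^sub>F x in at_right 0. (p + 2) * x powr (p + 1) \<noteq> 0"
      using eventually_at_right_less[of 0] by eventually_elim (use p in simp)
    show "\<forall>\<^sub>F x in at_right 0. (?f has_real_derivative (kern \<alpha> x - x powr (p - 1) / 2)) (at x)"
      using eventually_at_right_less[of 0]
    proof eventually_elim
      case (elim x)
      show ?case
        using p assms elim
        by (auto intro!: derivative_eq_intros partial_I_has_derivative simp: field_simps)
    qed
    show "\<forall>\<^sub>F x in at_right 0. ((\<lambda>x. x powr (p + 2)) has_real_derivative (p + 2) * x powr (p + 1)) (at x)"
      using eventually_at_right_less[of 0]
    proof eventually_elim
      case (elim x)
      show ?case
        using p elim by (auto intro!: derivative_eq_intros simp: field_simps)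
    qed
    show "((\<lambda>x. (kern \<alpha> x - x powr (p - 1) / 2) / ((p + 2) * x powr (p + 1))) \<longlongrightarrow> - 1 / (24 * (p + 2)))
        (at_right 0)"
      unfolding kern_def p(3) using p by (real_asymp simp: field_simps)
  qed
  moreover have "\<forall>\<^sub>F x in at_right 0. ?f x / x powr (p + 2) = (scaled_I \<alpha> x - 1 / (4 * (1 - \<alpha>))) / x\<^sup>2"
    using eventually_at_right_less[of 0]
  proof eventually_elim
    case (elim x)
    have "4 * (1 - \<alpha>) = 2 * p" by (simp add: p_def)
    then show ?case
      using elim p by (simp add: scaled_I_def powr_add powr_numeral diff_divide_distrib flip: p_def)
  qed
  moreover have "24 * (p + 2) = 48 * (2 - \<alpha>)" by (simp add: p_def)
  ultimately show ?thesis
    by (simp add: Lim_transform_eventually)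
qed

section \<open>The rescaled dispersion relation\<close>

text \<open>The functions below are the square of the rescaled dispersion relation, the relation itself,
  and their first and second derivatives on the positive half-line.\<close>

definition profile_sq :: "real \<Rightarrow> real \<Rightarrow> real" where
  "profile_sq \<alpha> x = x powr (2 * \<alpha>) * partial_I \<alpha> x"

definition profile_sq1 :: "real \<Rightarrow> real \<Rightarrow> real" where
  "profile_sq1 \<alpha> x = 2 * \<alpha> * x powr (2 * \<alpha> - 1) * partial_I \<alpha> x + (1 - cos x) / x"

definition profile_sq2 :: "real \<Rightarrow> real \<Rightarrow> real" where
  "profile_sq2 \<alpha> x = 2 * \<alpha> * (2 * \<alpha> - 1) * x powr (2 * \<alpha> - 2) * partial_I \<alpha> x
     + (2 * \<alpha> - 1) * (1 - cos x) / x\<^sup>2 + sin x / x"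

definition profile :: "real \<Rightarrow> real \<Rightarrow> real" where
  "profile \<alpha> x = sqrt (profile_sq \<alpha> x)"

definition profile1 :: "real \<Rightarrow> real \<Rightarrow> real" where
  "profile1 \<alpha> x = profile_sq1 \<alpha> x / (2 * sqrt (profile_sq \<alpha> x))"

definition profile2 :: "real \<Rightarrow> real \<Rightarrow> real" where
  "profile2 \<alpha> x = profile_sq2 \<alpha> x / (2 * sqrt (profile_sq \<alpha> x))
     - (profile_sq1 \<alpha> x)\<^sup>2 / (4 * profile_sq \<alpha> x * sqrt (profile_sq \<alpha> x))"

lemma profile_sq_pos: "\<alpha> < 1 \<Longrightarrow> 0 < x \<Longrightarrow> 0 < profile_sq \<alpha> x"
  by (simp add: profile_sq_def partial_I_pos)

lemma powr_mult_kern: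
  assumes "0 < x"
  shows "x powr (2 * \<alpha>) * kern \<alpha> x = (1 - cos x) / x"
    and "x powr (2 * \<alpha> - 1) * kern \<alpha> x = (1 - cos x) / x\<^sup>2"
  using assms by (simp_all add: kern_def powr_add powr_diff power2_eq_square)

lemma profile_sq_has_derivative:
  assumes "\<alpha> < 1" "0 < x"
  shows "(profile_sq \<alpha> has_real_derivative profile_sq1 \<alpha> x) (at x)"
proof -
  have "(profile_sq \<alpha> has_real_derivative
      2 * \<alpha> * x powr (2 * \<alpha> - 1) * partial_I \<alpha> x + x powr (2 * \<alpha>) * kern \<alpha> x) (at x)"
    unfolding profile_sq_def[abs_def] using assms
    by (auto intro!: derivative_eq_intros partial_I_has_derivative)
  then show ?thesis
    by (simp add: profile_sq1_def powr_mult_kern assms)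
qed

lemma profile_sq1_has_derivative:
  assumes "\<alpha> < 1" "0 < x"
  shows "(profile_sq1 \<alpha> has_real_derivative profile_sq2 \<alpha> x) (at x)"
proof -
  have "(profile_sq1 \<alpha> has_real_derivative
      2 * \<alpha> * ((2 * \<alpha> - 1) * x powr (2 * \<alpha> - 1 - 1) * partial_I \<alpha> x + x powr (2 * \<alpha> - 1) * kern \<alpha> x)
      + (sin x * x - (1 - cos x)) / (x * x)) (at x)"
    unfolding profile_sq1_def[abs_def] using assms
    by (auto intro!: derivative_eq_intros partial_I_has_derivative simp: algebra_simps)
  moreover have "2 * \<alpha> * ((2 * \<alpha> - 1) * x powr (2 * \<alpha> - 1 - 1) * partial_I \<alpha> x + x powr (2 * \<alpha> - 1) * kern \<alpha> x)
      + (sin x * x - (1 - cos x)) / (x * x) = profile_sq2 \<alpha> x"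
    unfolding powr_mult_kern(2)[OF assms(2)] profile_sq2_def
    using assms by (simp add: field_simps power2_eq_square)
  ultimately show ?thesis by simp
qed

lemma profile_has_derivative:
  assumes "\<alpha> < 1" "0 < x"
  shows "(profile \<alpha> has_real_derivative profile1 \<alpha> x) (at x)"
  unfolding profile_def[abs_def] profile1_def
  using profile_sq_pos[OF assms]
  by (auto intro!: derivative_eq_intros profile_sq_has_derivative assms simp: field_simps)

lemma profile1_has_derivative:
  assumes "\<alpha> < 1" "0 < x"
  shows "(profile1 \<alpha> has_real_derivative profile2 \<alpha> x) (at x)"
  unfolding profile1_def[abs_def] profile2_def
  using profile_sq_pos[OF assms]
  by (auto intro!: derivative_eq_intros profile_sq_has_derivative profile_sq1_has_derivative assms
      simp: field_simps power2_eq_square)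

section \<open>The rescaled dispersion relation at zero\<close>

lemma profile_sq_eq_scaled_I:
  assumes "0 < x"
  shows "profile_sq \<alpha> x = x\<^sup>2 * scaled_I \<alpha> x"
    and "profile_sq1 \<alpha> x = x * (2 * \<alpha> * scaled_I \<alpha> x + (1 - cos x) / x\<^sup>2)"
    and "profile_sq2 \<alpha> x = 2 * \<alpha> * (2 * \<alpha> - 1) * scaled_I \<alpha> x + (2 * \<alpha> - 1) * ((1 - cos x) / x\<^sup>2) + sin x / x"
  using assms
  by (simp_all add: profile_sq_def profile_sq1_def profile_sq2_def scaled_I_def powr_diff powr_numeral
      field_simps power2_eq_square)

lemma scaled_I_pos: "\<alpha> < 1 \<Longrightarrow> 0 < x \<Longrightarrow> 0 < scaled_I \<alpha> x"
  by (simp add: scaled_I_def partial_I_pos)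

lemma scaled_I_tendsto:
  assumes "0 < \<alpha>" "\<alpha> < 1"
  shows "(scaled_I \<alpha> \<longlongrightarrow> 1 / (4 * (1 - \<alpha>))) (at_right 0)"
proof -
  have "((\<lambda>x. 1 / (4 * (1 - \<alpha>)) + x\<^sup>2 * ((scaled_I \<alpha> x - 1 / (4 * (1 - \<alpha>))) / x\<^sup>2))
      \<longlongrightarrow> 1 / (4 * (1 - \<alpha>)) + 0\<^sup>2 * (- 1 / (48 * (2 - \<alpha>)))) (at_right 0)"
    by (intro tendsto_intros scaled_I_expansion assms)
  moreover have "\<forall>\<^sub>F x in at_right 0.
      1 / (4 * (1 - \<alpha>)) + x\<^sup>2 * ((scaled_I \<alpha> x - 1 / (4 * (1 - \<alpha>))) / x\<^sup>2) = scaled_I \<alpha> x"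
    using eventually_at_right_less[of 0] by eventually_elim simp
  ultimately show ?thesis
    by (simp add: Lim_transform_eventually)
qed

lemma profile1_tendsto_at_0:
  assumes "0 < \<alpha>" "\<alpha> < 1"
  shows "(profile1 \<alpha> \<longlongrightarrow> 1 / (2 * sqrt (1 - \<alpha>))) (at_right 0)"
proof -
  let ?c = "1 / (4 * (1 - \<alpha>))"
  have u: "((\<lambda>x::real. (1 - cos x) / x\<^sup>2) \<longlongrightarrow> 1 / 2) (at_right 0)"
    by real_asymp
  have "((\<lambda>x. (2 * \<alpha> * scaled_I \<alpha> x + (1 - cos x) / x\<^sup>2) / (2 * sqrt (scaled_I \<alpha> x)))
      \<longlongrightarrow> (2 * \<alpha> * ?c + 1 / 2) / (2 * sqrt ?c)) (at_right 0)"
    using assms by (intro u tendsto_intros scaled_I_tendsto) auto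
  moreover have "\<forall>\<^sub>F x in at_right 0.
      (2 * \<alpha> * scaled_I \<alpha> x + (1 - cos x) / x\<^sup>2) / (2 * sqrt (scaled_I \<alpha> x)) = profile1 \<alpha> x"
    using eventually_at_right_less[of 0]
    by eventually_elim (simp add: profile1_def profile_sq_eq_scaled_I real_sqrt_mult)
  moreover have "(2 * \<alpha> * ?c + 1 / 2) / (2 * sqrt ?c) = 1 / (2 * sqrt (1 - \<alpha>))"
  proof -
    have num: "2 * \<alpha> * ?c + 1 / 2 = 1 / (2 * (1 - \<alpha>))"
      using assms by (simp add: field_simps)
    have root: "sqrt ?c = 1 / (2 * sqrt (1 - \<alpha>))"
      unfolding real_sqrt_divide real_sqrt_mult by simp
    define r where "r = sqrt (1 - \<alpha>)"
    have r: "0 < r" "1 - \<alpha> = r * r"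
      using assms by (auto simp: r_def)
    show ?thesis
      unfolding num root r_def[symmetric] unfolding r(2) using r(1) by (simp add: field_simps)
  qed
  ultimately show ?thesis
    by (simp add: Lim_transform_eventually)
qed

text \<open>Put \<open>h = scaled_I \<alpha>\<close> and \<open>u = (1 - cos x) / x\<^sup>2\<close>. Then \<open>profile2 \<alpha> x\<close> is
  \<open>2 * h * profile_sq2 \<alpha> x - (2 * \<alpha> * h + u)\<^sup>2\<close> divided by \<open>4 * x * h * sqrt h\<close>. At \<open>x = 0\<close> the
  numerator vanishes: it is a quadratic polynomial in \<open>h\<close>, \<open>u\<close> and \<open>sin x / x\<close> which is zero at the
  limits \<open>1 / (4 * (1 - \<alpha>))\<close>, \<open>1 / 2\<close> and \<open>1\<close>. So each of the three is expanded to order \<open>x\<^sup>2\<close>; \<open>H\<close>,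
  \<open>U\<close> and \<open>S\<close> are the coefficients, and \<open>x\<^sup>2 * Q x\<close> is what remains of the numerator.\<close>

lemma profile2_tendsto_at_0:
  assumes "0 < \<alpha>" "\<alpha> < 1"
  shows "((\<lambda>x. profile2 \<alpha> x / x) \<longlongrightarrow> - sqrt (1 - \<alpha>) / (8 * (2 - \<alpha>))) (at_right 0)"
proof -
  define c where "c = 1 / (4 * (1 - \<alpha>))"
  define h where "h = scaled_I \<alpha>"
  define H where "H x = (h x - c) / x\<^sup>2" for x
  define U where "U x = ((1 - cos x) / x\<^sup>2 - 1 / 2) / x\<^sup>2" for x :: real
  define S where "S x = (sin x / x - 1) / x\<^sup>2" for x :: real
  have c: "0 < c" "4 * (1 - \<alpha>) * c = 1"
    using assms by (auto simp: c_def)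
  define Q where "Q x = (1 - 2 * \<alpha>) * H x + 2 * c * (S x - U x) - U x
      + x\<^sup>2 * (4 * \<alpha> * (\<alpha> - 1) * (H x)\<^sup>2 + 2 * H x * (S x - U x) - (U x)\<^sup>2)" for x
  have lim: "(H \<longlongrightarrow> - 1 / (48 * (2 - \<alpha>))) (at_right 0)"
      "(U \<longlongrightarrow> - 1 / 24) (at_right 0)" "(S \<longlongrightarrow> - 1 / 6) (at_right 0)"
      "(h \<longlongrightarrow> c) (at_right 0)"
    using scaled_I_expansion[OF assms] scaled_I_tendsto[OF assms]
    unfolding H_def[abs_def] U_def[abs_def] S_def[abs_def] h_def c_def
    by (simp_all, real_asymp+)
  have "((\<lambda>x. Q x / (4 * h x * sqrt (h x))) \<longlongrightarrow>
      ((1 - 2 * \<alpha>) * (- 1 / (48 * (2 - \<alpha>))) + 2 * c * (- 1 / 6 - (- 1 / 24)) - (- 1 / 24)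
       + 0\<^sup>2 * (4 * \<alpha> * (\<alpha> - 1) * (- 1 / (48 * (2 - \<alpha>)))\<^sup>2
           + 2 * (- 1 / (48 * (2 - \<alpha>))) * (- 1 / 6 - (- 1 / 24)) - (- 1 / 24)\<^sup>2))
      / (4 * c * sqrt c)) (at_right 0)" (is "(_ \<longlongrightarrow> ?L) _")
    unfolding Q_def[abs_def] using c(1) by (intro tendsto_intros lim) auto
  moreover have "\<forall>\<^sub>F x in at_right 0. Q x / (4 * h x * sqrt (h x)) = profile2 \<alpha> x / x"
    using eventually_at_right_less[of 0]
  proof eventually_elim
    case (elim x)
    have h: "0 < h x" "h x = c + x\<^sup>2 * H x"
      using elim scaled_I_pos[of \<alpha> x] assms by (auto simp: h_def H_def)
    have u: "(1 - cos x) / x\<^sup>2 = 1 / 2 + x\<^sup>2 * U x" and s: "sin x / x = 1 + x\<^sup>2 * S x"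
      using elim by (auto simp: U_def S_def)
    define W where "W = 2 * \<alpha> * h x + (1 - cos x) / x\<^sup>2"
    have Q: "2 * h x * profile_sq2 \<alpha> x - W\<^sup>2 = x\<^sup>2 * Q x"
    proof -
      \<comment> \<open>The difference is a multiple of the defining relation \<open>4 * (1 - \<alpha>) * c = 1\<close> of \<open>c\<close>.\<close>
      have "2 * h x * profile_sq2 \<alpha> x - W\<^sup>2 - x\<^sup>2 * Q x
          = (1 - 4 * (1 - \<alpha>) * c) * (\<alpha> * c + 2 * \<alpha> * x\<^sup>2 * H x) + (c * (1 - \<alpha>) - 1/4)"
        unfolding W_def profile_sq_eq_scaled_I(3)[OF elim] u s Q_def h_def[symmetric] h(2)
        by (simp add: algebra_simps power2_eq_square)
      also have "\<dots> = 0"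
        using c(2) by (simp add: algebra_simps)
      finally show ?thesis by simp
    qed
    have "profile2 \<alpha> x = profile_sq2 \<alpha> x / (2 * (x * sqrt (h x)))
        - W\<^sup>2 / (4 * x * h x * sqrt (h x))"
      using elim
      by (simp add: W_def profile2_def profile_sq_eq_scaled_I(1,2) real_sqrt_mult h_def[symmetric]
          power_mult_distrib power2_eq_square[of x])
    also have "\<dots> = (2 * h x * profile_sq2 \<alpha> x - W\<^sup>2) / (4 * x * h x * sqrt (h x))"
      using elim h(1) by (simp add: field_simps)
    finally show ?case
      unfolding Q using elim h(1) by (simp add: power2_eq_square)
  qed
  moreover have "?L = - sqrt (1 - \<alpha>) / (8 * (2 - \<alpha>))"
  proof -
    have num: "(1 - 2 * \<alpha>) * (- 1 / (48 * (2 - \<alpha>))) + 2 * c * (- 1 / 6 - (- 1 / 24)) - (- 1 / 24)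
        = - 1 / (16 * (1 - \<alpha>) * (2 - \<alpha>))"
      using assms unfolding c_def by (simp add: divide_simps) (simp add: algebra_simps)
    have root: "sqrt c = 1 / (2 * sqrt (1 - \<alpha>))"
      unfolding c_def real_sqrt_divide real_sqrt_mult by simp
    define r m where "r = sqrt (1 - \<alpha>)" and "m = 2 - \<alpha>"
    have r: "0 < r" "0 < m" "1 - \<alpha> = r * r"
      using assms by (auto simp: r_def m_def)
    have "?L = - 1 / (16 * (1 - \<alpha>) * m) / (4 * c * (1 / (2 * r)))"
      unfolding num root unfolding r_def[symmetric] m_def[symmetric] by simp
    also have "\<dots> = - r / (8 * m)"
      unfolding c_def r(3) using r(1,2) by (simp add: field_simps)
    finally show ?thesis
      by (simp only: r_def m_def)
  qed
  ultimately show ?thesis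
    by (simp add: Lim_transform_eventually)
qed

section \<open>The rescaled dispersion relation at infinity\<close>

lemma profile_sq_scaled_at_top:
  assumes "0 < x"
  shows "sqrt (profile_sq \<alpha> x) = x powr \<alpha> * sqrt (partial_I \<alpha> x)"
    and "x powr (1 - 2 * \<alpha>) * profile_sq1 \<alpha> x = 2 * \<alpha> * partial_I \<alpha> x + (1 - cos x) * x powr (- 2 * \<alpha>)"
    and "x powr (2 - 2 * \<alpha>) * profile_sq2 \<alpha> x = 2 * \<alpha> * (2 * \<alpha> - 1) * partial_I \<alpha> x
      + (2 * \<alpha> - 1) * ((1 - cos x) * x powr (- 2 * \<alpha>)) + sin x * x powr (1 - 2 * \<alpha>)"
proof -
  have "sqrt (x powr (2 * \<alpha>)) = x powr \<alpha>"
    by (rule real_sqrt_unique) (simp_all add: power2_eq_square flip: powr_add)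
  then show "sqrt (profile_sq \<alpha> x) = x powr \<alpha> * sqrt (partial_I \<alpha> x)"
    by (simp add: profile_sq_def real_sqrt_mult)
  have m: "x powr (- 2 * \<alpha>) = 1 / x powr (2 * \<alpha>)"
    using powr_minus_divide[of x "2 * \<alpha>"] by simp
  show "x powr (1 - 2 * \<alpha>) * profile_sq1 \<alpha> x = 2 * \<alpha> * partial_I \<alpha> x + (1 - cos x) * x powr (- 2 * \<alpha>)"
    unfolding m profile_sq1_def powr_diff using assms by (simp add: field_simps)
  show "x powr (2 - 2 * \<alpha>) * profile_sq2 \<alpha> x = 2 * \<alpha> * (2 * \<alpha> - 1) * partial_I \<alpha> x
      + (2 * \<alpha> - 1) * ((1 - cos x) * x powr (- 2 * \<alpha>)) + sin x * x powr (1 - 2 * \<alpha>)"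
    unfolding m profile_sq2_def powr_diff using assms
    by (simp add: powr_numeral field_simps power2_eq_square)
qed

lemma one_minus_cos_powr_tendsto_0:
  assumes "0 < (\<alpha> :: real)"
  shows "((\<lambda>x. (1 - cos x) * x powr (- 2 * \<alpha>)) \<longlongrightarrow> 0) at_top"
proof (rule tendsto_sandwich)
  show "\<forall>\<^sub>F x in at_top. 0 \<le> (1 - cos x) * x powr (- 2 * \<alpha>)"
    by (rule always_eventually) simp
  show "\<forall>\<^sub>F x in at_top. (1 - cos x) * x powr (- 2 * \<alpha>) \<le> 2 * x powr (- 2 * \<alpha>)"
  proof (rule always_eventually, rule allI)
    show "(1 - cos x) * x powr (- 2 * \<alpha>) \<le> 2 * x powr (- 2 * \<alpha>)" for x
      using cos_ge_minus_one[of x] by (intro mult_right_mono) auto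
  qed
  show "((\<lambda>x. 2 * x powr (- 2 * \<alpha>)) \<longlongrightarrow> 0) at_top"
    using assms by real_asymp
qed simp

lemma profile1_tendsto_at_top:
  assumes "0 < \<alpha>" "\<alpha> < 1"
  shows "((\<lambda>x. x powr (1 - \<alpha>) * profile1 \<alpha> x) \<longlongrightarrow> \<alpha> * sqrt (I_const \<alpha>)) at_top"
proof -
  note I = I_const_pos[OF assms]
  have "((\<lambda>x. (2 * \<alpha> * partial_I \<alpha> x + (1 - cos x) * x powr (- 2 * \<alpha>)) / (2 * sqrt (partial_I \<alpha> x)))
      \<longlongrightarrow> (2 * \<alpha> * I_const \<alpha> + 0) / (2 * sqrt (I_const \<alpha>))) at_top"
    using I assms by (intro one_minus_cos_powr_tendsto_0 partial_I_tendsto tendsto_intros) auto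
  moreover have "\<forall>\<^sub>F x in at_top.
      (2 * \<alpha> * partial_I \<alpha> x + (1 - cos x) * x powr (- 2 * \<alpha>)) / (2 * sqrt (partial_I \<alpha> x))
      = x powr (1 - \<alpha>) * profile1 \<alpha> x"
    using eventually_gt_at_top[of 0]
  proof eventually_elim
    case (elim x)
    have "x powr (1 - \<alpha>) / x powr \<alpha> = x powr (1 - 2 * \<alpha>)"
      by (simp flip: powr_diff)
    then have "x powr (1 - \<alpha>) * profile1 \<alpha> x
        = x powr (1 - 2 * \<alpha>) * profile_sq1 \<alpha> x / (2 * sqrt (partial_I \<alpha> x))"
      using elim by (simp add: profile1_def profile_sq_scaled_at_top(1) field_simps)
    then show ?case
      by (simp only: profile_sq_scaled_at_top(2)[OF elim])
  qed
  moreover have "(2 * \<alpha> * I_const \<alpha> + 0) / (2 * sqrt (I_const \<alpha>)) = \<alpha> * sqrt (I_const \<alpha>)"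
  proof -
    have "(2 * \<alpha> * I_const \<alpha> + 0) / (2 * sqrt (I_const \<alpha>)) = \<alpha> * (I_const \<alpha> / sqrt (I_const \<alpha>))"
      by simp
    also have "\<dots> = \<alpha> * sqrt (I_const \<alpha>)"
      using I by (simp only: real_div_sqrt less_imp_le)
    finally show ?thesis .
  qed
  ultimately show ?thesis
    by (simp add: Lim_transform_eventually)
qed

text \<open>The terms of \<open>x powr (2 - \<alpha>) * profile2 \<alpha> x\<close> which converge for every \<open>\<alpha>\<close>: all of them except
  the one with \<open>sin x\<close>.\<close>

definition smooth_part :: "real \<Rightarrow> real \<Rightarrow> real" where
  "smooth_part \<alpha> x = (2 * \<alpha> * (2 * \<alpha> - 1) * partial_I \<alpha> x
        + (2 * \<alpha> - 1) * ((1 - cos x) * x powr (- 2 * \<alpha>))) / (2 * sqrt (partial_I \<alpha> x))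
      - (2 * \<alpha> * partial_I \<alpha> x + (1 - cos x) * x powr (- 2 * \<alpha>))\<^sup>2
        / (4 * partial_I \<alpha> x * sqrt (partial_I \<alpha> x))"

text \<open>The weight \<open>x powr (2 - \<alpha>)\<close> splits as \<open>x powr (2 - 2 * \<alpha>) * x powr \<alpha>\<close> in the first term of
  \<open>profile2\<close> and as \<open>(x powr (1 - 2 * \<alpha>))\<^sup>2 * x powr (3 * \<alpha>)\<close> in the second. The last factors cancel the
  powers of \<open>x\<close> in the denominators, and the others normalise the derivatives of the square.\<close>

lemma profile2_decomposition:
  assumes "\<alpha> < 1" "0 < x"
  shows "x powr (2 - \<alpha>) * profile2 \<alpha> x
    = smooth_part \<alpha> x + sin x * x powr (1 - 2 * \<alpha>) / (2 * sqrt (partial_I \<alpha> x))"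
proof -
  define J where "J = partial_I \<alpha> x"
  have J: "0 < J"
    using partial_I_pos assms by (simp add: J_def)
  have e1: "x powr (2 - \<alpha>) = x powr (2 - 2 * \<alpha>) * x powr \<alpha>"
    by (simp flip: powr_add)
  have e2: "x powr (2 - \<alpha>) = (x powr (1 - 2 * \<alpha>))\<^sup>2 * (x powr (2 * \<alpha>) * x powr \<alpha>)"
    by (simp add: power2_eq_square flip: powr_add)
  have "x powr (2 - \<alpha>) * profile2 \<alpha> x = x powr (2 - \<alpha>) * (profile_sq2 \<alpha> x / (2 * (x powr \<alpha> * sqrt J)))
      - x powr (2 - \<alpha>) * ((profile_sq1 \<alpha> x)\<^sup>2 / (4 * (x powr (2 * \<alpha>) * J) * (x powr \<alpha> * sqrt J)))"
    unfolding profile2_def profile_sq_scaled_at_top(1)[OF assms(2)]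
    by (simp add: profile_sq_def J_def right_diff_distrib)
  also have "x powr (2 - \<alpha>) * (profile_sq2 \<alpha> x / (2 * (x powr \<alpha> * sqrt J)))
      = x powr (2 - 2 * \<alpha>) * profile_sq2 \<alpha> x / (2 * sqrt J)"
    unfolding e1 using assms by simp
  also have "x powr (2 - \<alpha>) * ((profile_sq1 \<alpha> x)\<^sup>2 / (4 * (x powr (2 * \<alpha>) * J) * (x powr \<alpha> * sqrt J)))
      = (x powr (1 - 2 * \<alpha>) * profile_sq1 \<alpha> x)\<^sup>2 / (4 * J * sqrt J)"
    unfolding e2 using assms by (simp add: power_mult_distrib)
  finally show ?thesis
    unfolding profile_sq_scaled_at_top(2,3)[OF assms(2)] smooth_part_def J_def[symmetric]
    by (simp add: add_divide_distrib)
qed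

lemma smooth_part_tendsto:
  assumes "0 < \<alpha>" "\<alpha> < 1"
  shows "(smooth_part \<alpha> \<longlongrightarrow> - \<alpha> * (1 - \<alpha>) * sqrt (I_const \<alpha>)) at_top"
proof -
  define I where "I = I_const \<alpha>"
  have I: "0 < I"
    using I_const_pos[OF assms] by (simp add: I_def)
  have "(smooth_part \<alpha> \<longlongrightarrow> (2 * \<alpha> * (2 * \<alpha> - 1) * I + (2 * \<alpha> - 1) * 0) / (2 * sqrt I)
      - (2 * \<alpha> * I + 0)\<^sup>2 / (4 * I * sqrt I)) at_top"
    unfolding smooth_part_def[abs_def] I_def using I assms
    by (intro one_minus_cos_powr_tendsto_0 partial_I_tendsto tendsto_intros) (auto simp: I_def)
  moreover have "(2 * \<alpha> * (2 * \<alpha> - 1) * I + (2 * \<alpha> - 1) * 0) / (2 * sqrt I)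
      - (2 * \<alpha> * I + 0)\<^sup>2 / (4 * I * sqrt I) = - \<alpha> * (1 - \<alpha>) * sqrt I"
  proof -
    define r where "r = sqrt I"
    have r: "0 < r" "I = r * r"
      using I by (auto simp: r_def)
    show ?thesis
      unfolding r_def[symmetric] unfolding r(2) using r(1)
      by (simp add: field_simps power2_eq_square)
  qed
  ultimately show ?thesis by (simp add: I_def)
qed

section \<open>Upper and lower limits of perturbed sine waves\<close>

text \<open>The bound from above is \<open>sin \<le> 1\<close>; it is attained along the points where the sine equals \<open>1\<close>.
  The phase \<open>\<phi>\<close> is there so that the lower limit follows by applying the result to \<open>- f\<close>, which
  shifts the sine by \<open>pi\<close>.\<close>

lemma Limsup_sin_perturbation:
  fixes f :: "real \<Rightarrow> real"
  assumes "0 < d" "0 \<le> c" and lim: "((\<lambda>x. f x - c * sin (d * x + \<phi>)) \<longlongrightarrow> b) at_top"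
  shows "Limsup at_top (\<lambda>x. ereal (f x)) = ereal (b + c)"
proof (rule antisym)
  have bnd: "c * sin (d * x + \<phi>) \<le> c" for x
    using \<open>0 \<le> c\<close> mult_left_mono[of "sin (d * x + \<phi>)" 1 c] by simp
  have "Limsup at_top (\<lambda>x. ereal (f x)) \<le> Limsup at_top (\<lambda>x. ereal (f x - c * sin (d * x + \<phi>) + c))"
    by (intro Limsup_mono always_eventually allI) (use bnd in \<open>simp add: algebra_simps\<close>)
  also have "\<dots> = ereal (b + c)"
    by (intro lim_imp_Limsup tendsto_intros lim) simp
  finally show "Limsup at_top (\<lambda>x. ereal (f x)) \<le> ereal (b + c)" .
next
  define s where "s n = (pi / 2 - \<phi> + real n * (2 * pi)) / d" for n
  have s: "filterlim s at_top sequentially"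
    unfolding s_def[abs_def] using \<open>0 < d\<close> pi_gt_zero by real_asymp
  have sin_s: "sin (d * s n + \<phi>) = 1" for n
  proof -
    have "d * s n + \<phi> = pi / 2 + 2 * real n * pi"
      using \<open>0 < d\<close> by (simp add: s_def)
    then show ?thesis
      by (simp only: sin_add sin_2npi cos_2npi) simp
  qed
  have "(\<lambda>n. f (s n) - c * sin (d * s n + \<phi>)) \<longlonglongrightarrow> b"
    by (rule filterlim_compose[OF lim s])
  then have "(\<lambda>n. f (s n) - c + c) \<longlonglongrightarrow> b + c"
    unfolding sin_s by (intro tendsto_intros) simp
  then have fs: "(\<lambda>n. f (s n)) \<longlonglongrightarrow> b + c" by simp
  show "ereal (b + c) \<le> Limsup at_top (\<lambda>x. ereal (f x))"
  proof (rule ccontr)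
    assume "\<not> ?thesis"
    then have "Limsup at_top (\<lambda>x. ereal (f x)) < ereal (b + c)"
      by (simp only: not_le)
    then obtain y where y: "Limsup at_top (\<lambda>x. ereal (f x)) < y" "y < ereal (b + c)"
      using dense by blast
    have "\<forall>\<^sub>F x in at_top. ereal (f x) < y"
      by (rule Limsup_lessD[OF y(1)])
    then have "\<forall>\<^sub>F n in sequentially. ereal (f (s n)) < y"
      by (rule eventually_compose_filterlim[OF _ s])
    moreover have "\<forall>\<^sub>F n in sequentially. y < ereal (f (s n))"
      by (rule order_tendstoD(1)[OF _ y(2)]) (use fs in simp)
    ultimately have "\<forall>\<^sub>F n in sequentially. False"
      by eventually_elim simp
    then show False by simp
  qed
qed

lemma Liminf_sin_perturbation:
  fixes f :: "real \<Rightarrow> real"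
  assumes "0 < d" "0 \<le> c" and lim: "((\<lambda>x. f x - c * sin (d * x)) \<longlongrightarrow> b) at_top"
  shows "Liminf at_top (\<lambda>x. ereal (f x)) = ereal (b - c)"
proof -
  have "((\<lambda>x. - f x - c * sin (d * x + pi)) \<longlongrightarrow> - b) at_top"
    using tendsto_minus[OF lim] by simp
  then have "Limsup at_top (\<lambda>x. ereal (- f x)) = ereal (- b + c)"
    by (rule Limsup_sin_perturbation[OF assms(1,2)])
  then have "- Liminf at_top (\<lambda>x. ereal (f x)) = ereal (- b + c)"
    by (simp flip: ereal_Limsup_uminus)
  then have "Liminf at_top (\<lambda>x. ereal (f x)) = - ereal (- b + c)"
    by (metis ereal_uminus_uminus)
  then show ?thesis by simp
qed

text \<open>Both \<open>f\<close> and its reflection \<open>\<lambda>x. f (- x)\<close> are perturbations of the same sine wave at \<open>+\<infinity>\<close>, so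
  one statement at \<open>at_infinity\<close> covers both directions.\<close>

lemma Liminf_Limsup_sin_abs_perturbation:
  fixes f :: "real \<Rightarrow> real"
  assumes "0 < d" "0 \<le> c" and lim: "((\<lambda>x. f x - c * sin (d * \<bar>x\<bar>)) \<longlongrightarrow> b) at_infinity"
  shows "Liminf at_top (\<lambda>x. ereal (f x)) = ereal (b - c)"
    and "Limsup at_top (\<lambda>x. ereal (f x)) = ereal (b + c)"
    and "Liminf at_bot (\<lambda>x. ereal (f x)) = ereal (b - c)"
    and "Limsup at_bot (\<lambda>x. ereal (f x)) = ereal (b + c)"
proof -
  have "((\<lambda>x. f x - c * sin (d * \<bar>x\<bar>)) \<longlongrightarrow> b) at_top"
    by (rule filterlim_mono[OF lim order_refl at_top_le_at_infinity])
  then have top: "((\<lambda>x. f x - c * sin (d * x)) \<longlongrightarrow> b) at_top"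
    by (rule Lim_transform_eventually)
       (use eventually_ge_at_top[of 0] in \<open>eventually_elim, simp\<close>)
  have "((\<lambda>x. f (- x) - c * sin (d * \<bar>- x\<bar>)) \<longlongrightarrow> b) at_top"
    by (rule filterlim_compose[OF filterlim_mono[OF lim order_refl at_bot_le_at_infinity]
          filterlim_uminus_at_bot_at_top])
  then have bot: "((\<lambda>x. f (- x) - c * sin (d * x)) \<longlongrightarrow> b) at_top"
    by (rule Lim_transform_eventually)
       (use eventually_ge_at_top[of 0] in \<open>eventually_elim, simp\<close>)
  show "Liminf at_top (\<lambda>x. ereal (f x)) = ereal (b - c)"
    by (rule Liminf_sin_perturbation[OF assms(1,2) top])
  show "Limsup at_top (\<lambda>x. ereal (f x)) = ereal (b + c)"
    using top by (intro Limsup_sin_perturbation[OF assms(1,2), where \<phi> = 0]) simp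
  show "Liminf at_bot (\<lambda>x. ereal (f x)) = ereal (b - c)"
    using Liminf_sin_perturbation[OF assms(1,2) bot]
    by (simp add: at_bot_mirror Liminf_filtermap_eq)
  show "Limsup at_bot (\<lambda>x. ereal (f x)) = ereal (b + c)"
    using bot Limsup_sin_perturbation[OF assms(1,2), where \<phi> = 0 and f = "\<lambda>x. f (- x)"]
    by (simp add: at_bot_mirror Limsup_filtermap_eq)
qed

section \<open>Reduction of \<open>omega\<close> to the rescaled relation\<close>

definition omega_scale :: "real \<Rightarrow> real \<Rightarrow> real \<Rightarrow> real \<Rightarrow> real" where
  "omega_scale \<rho> \<kappa> \<delta> \<alpha> = 2 * sqrt (\<kappa> / \<rho>) * \<delta> powr (- \<alpha>)"

lemma omega_integral:
  assumes "\<alpha> < 1" "0 < x"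
  shows "((\<lambda>z. (1 - cos (x * z)) / \<bar>z\<bar> powr (1 + 2 * \<alpha>)) has_integral 2 * profile_sq \<alpha> x) {-1..1}"
proof -
  let ?f = "\<lambda>z. (1 - cos (x * z)) / \<bar>z\<bar> powr (1 + 2 * \<alpha>)"
  have "(kern \<alpha> has_integral partial_I \<alpha> x) {0..x}"
    unfolding partial_I_def using assms by (intro integrable_integral kern_integrable_Icc) auto
  from has_integral_stretch_real[OF this, of x]
  have "((\<lambda>z. kern \<alpha> (x * z)) has_integral partial_I \<alpha> x / x) {0..1}"
    using assms by (simp add: image_divide_atLeastAtMost)
  from has_integral_mult_right[OF this, of "x powr (1 + 2 * \<alpha>)"]
  have "((\<lambda>z. x powr (1 + 2 * \<alpha>) * kern \<alpha> (x * z)) has_integral profile_sq \<alpha> x) {0..1}"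
    using assms by (simp add: profile_sq_def powr_add)
  then have pos: "(?f has_integral profile_sq \<alpha> x) {0..1}"
    by (rule has_integral_eq[rotated]) (use assms in \<open>simp add: kern_def powr_mult\<close>)
  then have "((\<lambda>z. ?f (- z)) has_integral profile_sq \<alpha> x) {- 1..- 0}"
    by (subst has_integral_reflect_real)
  then have "(?f has_integral profile_sq \<alpha> x) {- 1..0}"
    by simp
  from has_integral_combine[OF _ _ this pos] show ?thesis by simp
qed

lemma omega_eq_profile:
  assumes "\<rho> > 0" "\<kappa> > 0" "\<delta> > 0" "\<alpha> < 1" "\<xi> \<noteq> 0"
  shows "omega \<rho> \<kappa> \<delta> \<alpha> \<xi> = omega_scale \<rho> \<kappa> \<delta> \<alpha> * profile \<alpha> (\<delta> * \<bar>\<xi>\<bar>)"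
proof -
  have "cos (\<xi> * \<delta> * z) = cos (\<delta> * \<bar>\<xi>\<bar> * z)" for z
    by (cases "0 \<le> \<xi>") (simp_all add: mult.commute)
  then have int: "integral {-1..1} (\<lambda>z. (1 - cos (\<xi> * \<delta> * z)) / \<bar>z\<bar> powr (1 + 2 * \<alpha>))
      = 2 * profile_sq \<alpha> (\<delta> * \<bar>\<xi>\<bar>)"
    using omega_integral[of \<alpha> "\<delta> * \<bar>\<xi>\<bar>"] assms by (simp add: integral_unique)
  have "2 * \<kappa> / (\<rho> * \<delta> powr (2 * \<alpha>)) * (2 * profile_sq \<alpha> (\<delta> * \<bar>\<xi>\<bar>))
      = (omega_scale \<rho> \<kappa> \<delta> \<alpha>)\<^sup>2 * profile_sq \<alpha> (\<delta> * \<bar>\<xi>\<bar>)"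
    using assms by (simp add: omega_scale_def power_mult_distrib powr_power powr_minus field_simps)
  moreover have "0 \<le> omega_scale \<rho> \<kappa> \<delta> \<alpha>"
    using assms by (simp add: omega_scale_def)
  ultimately show ?thesis
    unfolding omega_def int profile_def by (simp add: real_sqrt_mult)
qed

lemma has_derivative_even_dilation:
  fixes g :: "real \<Rightarrow> real"
  assumes "0 < \<delta>" "\<xi> \<noteq> 0" "(g has_real_derivative g') (at (\<delta> * \<bar>\<xi>\<bar>))"
  shows "((\<lambda>\<xi>. g (\<delta> * \<bar>\<xi>\<bar>)) has_real_derivative sgn \<xi> * \<delta> * g') (at \<xi>)"
proof -
  have "((\<lambda>\<eta>. sgn \<xi> * \<eta>) has_real_derivative sgn \<xi>) (at \<xi>)"
    by (auto intro!: derivative_eq_intros)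
  then have "(abs has_real_derivative sgn \<xi>) (at \<xi>)"
    by (rule has_field_derivative_transform_within_open[of _ _ _ "{\<eta>. 0 < sgn \<xi> * \<eta>}"])
       (use assms(2) in \<open>auto intro!: open_Collect_less continuous_intros simp: sgn_if\<close>)
  then have "((\<lambda>\<xi>. \<delta> * \<bar>\<xi>\<bar>) has_real_derivative \<delta> * sgn \<xi>) (at \<xi>)"
    by (rule DERIV_cmult)
  from DERIV_chain2[OF assms(3) this] show ?thesis
    by (simp add: mult_ac)
qed

lemma omega_has_derivative:
  assumes "\<rho> > 0" "\<kappa> > 0" "\<delta> > 0" "\<alpha> < 1" "\<xi> \<noteq> 0"
  shows "(omega \<rho> \<kappa> \<delta> \<alpha> has_real_derivative
    omega_scale \<rho> \<kappa> \<delta> \<alpha> * \<delta> * sgn \<xi> * profile1 \<alpha> (\<delta> * \<bar>\<xi>\<bar>)) (at \<xi>)"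
proof -
  have "((\<lambda>\<xi>. omega_scale \<rho> \<kappa> \<delta> \<alpha> * profile \<alpha> (\<delta> * \<bar>\<xi>\<bar>)) has_real_derivative
      omega_scale \<rho> \<kappa> \<delta> \<alpha> * (sgn \<xi> * \<delta> * profile1 \<alpha> (\<delta> * \<bar>\<xi>\<bar>))) (at \<xi>)"
    using assms by (intro DERIV_cmult has_derivative_even_dilation profile_has_derivative) auto
  then have "(omega \<rho> \<kappa> \<delta> \<alpha> has_real_derivative
      omega_scale \<rho> \<kappa> \<delta> \<alpha> * (sgn \<xi> * \<delta> * profile1 \<alpha> (\<delta> * \<bar>\<xi>\<bar>))) (at \<xi>)"
    by (rule has_field_derivative_transform_within_open[of _ _ _ "- {0}"])
       (use assms omega_eq_profile[OF assms(1-4)] in auto)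
  then show ?thesis by (simp add: mult_ac)
qed

text \<open>Differentiating once more produces a second factor \<open>sgn \<xi>\<close>; the sign itself is constant on the
  half-line containing \<open>\<xi>\<close>, and the two factors cancel.\<close>

lemma deriv_omega_has_derivative:
  assumes "\<rho> > 0" "\<kappa> > 0" "\<delta> > 0" "\<alpha> < 1" "\<xi> \<noteq> 0"
  shows "(deriv (omega \<rho> \<kappa> \<delta> \<alpha>) has_real_derivative
    omega_scale \<rho> \<kappa> \<delta> \<alpha> * \<delta>\<^sup>2 * profile2 \<alpha> (\<delta> * \<bar>\<xi>\<bar>)) (at \<xi>)"
proof -
  \<comment> \<open>The open half-line on the side of \<open>\<xi>\<close>.\<close>
  let ?S = "{\<eta>. 0 < sgn \<xi> * \<eta>}"
  have "((\<lambda>\<eta>. omega_scale \<rho> \<kappa> \<delta> \<alpha> * \<delta> * sgn \<xi> * profile1 \<alpha> (\<delta> * \<bar>\<eta>\<bar>)) has_real_derivative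
      omega_scale \<rho> \<kappa> \<delta> \<alpha> * \<delta> * sgn \<xi> * (sgn \<xi> * \<delta> * profile2 \<alpha> (\<delta> * \<bar>\<xi>\<bar>))) (at \<xi>)"
    using assms by (intro DERIV_cmult has_derivative_even_dilation profile1_has_derivative) auto
  then have "(deriv (omega \<rho> \<kappa> \<delta> \<alpha>) has_real_derivative
      omega_scale \<rho> \<kappa> \<delta> \<alpha> * \<delta> * sgn \<xi> * (sgn \<xi> * \<delta> * profile2 \<alpha> (\<delta> * \<bar>\<xi>\<bar>))) (at \<xi>)"
  proof (rule has_field_derivative_transform_within_open)
    show "open ?S"
      by (intro open_Collect_less continuous_intros)
    show "\<xi> \<in> ?S"
      using assms(5) by (simp add: sgn_if)
    fix \<eta> assume "\<eta> \<in> ?S"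
    then have "\<eta> \<noteq> 0" "sgn \<eta> = sgn \<xi>"
      by (auto simp: sgn_if split: if_splits)
    then show "omega_scale \<rho> \<kappa> \<delta> \<alpha> * \<delta> * sgn \<xi> * profile1 \<alpha> (\<delta> * \<bar>\<eta>\<bar>)
        = deriv (omega \<rho> \<kappa> \<delta> \<alpha>) \<eta>"
      using DERIV_imp_deriv[OF omega_has_derivative[OF assms(1-4), of \<eta>]] by simp
  qed
  moreover have "sgn \<xi> * sgn \<xi> = 1"
    using assms(5) by (simp add: sgn_if)
  ultimately show ?thesis
    by (simp add: power2_eq_square mult_ac)
qed

lemma deriv_omega:
  assumes "\<rho> > 0" "\<kappa> > 0" "\<delta> > 0" "\<alpha> < 1" "\<xi> \<noteq> 0"
  shows "deriv (omega \<rho> \<kappa> \<delta> \<alpha>) \<xi>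
      = omega_scale \<rho> \<kappa> \<delta> \<alpha> * \<delta> * sgn \<xi> * profile1 \<alpha> (\<delta> * \<bar>\<xi>\<bar>)"
    and "deriv (deriv (omega \<rho> \<kappa> \<delta> \<alpha>)) \<xi>
      = omega_scale \<rho> \<kappa> \<delta> \<alpha> * \<delta>\<^sup>2 * profile2 \<alpha> (\<delta> * \<bar>\<xi>\<bar>)"
  using omega_has_derivative[OF assms] deriv_omega_has_derivative[OF assms]
  by (simp_all add: DERIV_imp_deriv)

section \<open>Limits of the derivatives of \<open>omega\<close>\<close>

text \<open>Because \<open>\<omega>\<close> depends on \<open>\<bar>\<xi>\<bar>\<close> only, the limits are proved for the two-sided filters \<open>at 0\<close> and
  \<open>at_infinity\<close>, with a factor \<open>sgn \<xi>\<close> in front of the odd function \<open>\<omega>'\<close>, and restricted to each side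
  at the end.\<close>

lemma filterlim_dilated_abs_at_0: "0 < \<delta> \<Longrightarrow> filterlim (\<lambda>\<xi>. \<delta> * \<bar>\<xi>\<bar>) (at_right 0) (at (0::real))"
  unfolding filterlim_at
  by (auto intro!: tendsto_eq_intros simp: eventually_at_filter)

lemma filterlim_dilated_abs_at_infinity:
  "0 < \<delta> \<Longrightarrow> filterlim (\<lambda>\<xi>. \<delta> * \<bar>\<xi>\<bar>) at_top (at_infinity :: real filter)"
  using filterlim_tendsto_pos_mult_at_top[OF tendsto_const _ filterlim_norm_at_top[where 'a = real]]
  by (simp only: real_norm_def)

lemma eventually_nonzero_at_infinity: "\<forall>\<^sub>F \<xi> in at_infinity. \<xi> \<noteq> (0::real)"
  unfolding eventually_at_infinity by (intro exI[of _ 1]) auto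

lemma deriv_omega_tendsto_at_0:
  assumes "\<rho> > 0" "\<kappa> > 0" "\<delta> > 0" "0 < \<alpha>" "\<alpha> < 1"
  shows "((\<lambda>\<xi>. sgn \<xi> * deriv (omega \<rho> \<kappa> \<delta> \<alpha>) \<xi>)
    \<longlongrightarrow> sqrt \<kappa> * \<delta> powr (1 - \<alpha>) / sqrt ((1 - \<alpha>) * \<rho>)) (at 0)"
proof -
  let ?K = "omega_scale \<rho> \<kappa> \<delta> \<alpha>"
  have "((\<lambda>\<xi>. ?K * \<delta> * profile1 \<alpha> (\<delta> * \<bar>\<xi>\<bar>)) \<longlongrightarrow> ?K * \<delta> * (1 / (2 * sqrt (1 - \<alpha>)))) (at 0)"
    using assms
    by (intro tendsto_intros filterlim_compose[OF profile1_tendsto_at_0 filterlim_dilated_abs_at_0])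
  moreover have "?K * \<delta> * (1 / (2 * sqrt (1 - \<alpha>))) = sqrt \<kappa> * \<delta> powr (1 - \<alpha>) / sqrt ((1 - \<alpha>) * \<rho>)"
  proof -
    have "\<delta> powr (1 - \<alpha>) = \<delta> powr (- \<alpha>) * \<delta>"
      using assms powr_add[of \<delta> "- \<alpha>" 1] by simp
    then show ?thesis
      by (simp add: omega_scale_def real_sqrt_mult real_sqrt_divide)
  qed
  moreover have "\<forall>\<^sub>F \<xi> in at 0. ?K * \<delta> * profile1 \<alpha> (\<delta> * \<bar>\<xi>\<bar>) = sgn \<xi> * deriv (omega \<rho> \<kappa> \<delta> \<alpha>) \<xi>"
    using eventually_neq_at_within[of 0]
    by eventually_elim (use assms in \<open>simp add: deriv_omega(1) sgn_if\<close>)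
  ultimately show ?thesis
    by (simp add: Lim_transform_eventually)
qed

lemma deriv_omega_tendsto_at_infinity:
  assumes "\<rho> > 0" "\<kappa> > 0" "\<delta> > 0" "0 < \<alpha>" "\<alpha> < 1"
  shows "((\<lambda>\<xi>. sgn \<xi> * (\<bar>\<xi>\<bar> powr (1 - \<alpha>) * deriv (omega \<rho> \<kappa> \<delta> \<alpha>) \<xi>))
    \<longlongrightarrow> 2 * \<alpha> * sqrt (\<kappa> / \<rho> * I_const \<alpha>)) at_infinity"
proof -
  have "((\<lambda>\<xi>. 2 * sqrt (\<kappa> / \<rho>) * ((\<delta> * \<bar>\<xi>\<bar>) powr (1 - \<alpha>) * profile1 \<alpha> (\<delta> * \<bar>\<xi>\<bar>)))
      \<longlongrightarrow> 2 * sqrt (\<kappa> / \<rho>) * (\<alpha> * sqrt (I_const \<alpha>))) at_infinity"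
    using assms
    by (intro tendsto_mult_left
        filterlim_compose[OF profile1_tendsto_at_top filterlim_dilated_abs_at_infinity])
  moreover have "2 * sqrt (\<kappa> / \<rho>) * (\<alpha> * sqrt (I_const \<alpha>)) = 2 * \<alpha> * sqrt (\<kappa> / \<rho> * I_const \<alpha>)"
    unfolding real_sqrt_mult[of "\<kappa> / \<rho>"] by simp
  moreover have "\<forall>\<^sub>F \<xi> in at_infinity.
      2 * sqrt (\<kappa> / \<rho>) * ((\<delta> * \<bar>\<xi>\<bar>) powr (1 - \<alpha>) * profile1 \<alpha> (\<delta> * \<bar>\<xi>\<bar>))
      = sgn \<xi> * (\<bar>\<xi>\<bar> powr (1 - \<alpha>) * deriv (omega \<rho> \<kappa> \<delta> \<alpha>) \<xi>)"
    using eventually_nonzero_at_infinity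
  proof eventually_elim
    case (elim \<xi>)
    have "\<delta> powr (1 - \<alpha>) = \<delta> powr (- \<alpha>) * \<delta>"
      using assms powr_add[of \<delta> "- \<alpha>" 1] by simp
    moreover have "sgn \<xi> * sgn \<xi> = 1"
      using elim by (simp add: sgn_if)
    ultimately show ?case
      using assms elim by (simp add: deriv_omega(1) omega_scale_def powr_mult)
  qed
  ultimately show ?thesis
    by (simp add: Lim_transform_eventually)
qed

lemma deriv2_omega_tendsto_at_0:
  assumes "\<rho> > 0" "\<kappa> > 0" "\<delta> > 0" "0 < \<alpha>" "\<alpha> < 1"
  shows "((\<lambda>\<xi>. inverse \<bar>\<xi>\<bar> * deriv (deriv (omega \<rho> \<kappa> \<delta> \<alpha>)) \<xi>)
      \<longlongrightarrow> - (sqrt (\<kappa> * (1 - \<alpha>)) * \<delta> powr (3 - \<alpha>) / (4 * (2 - \<alpha>) * sqrt \<rho>))) (at 0)"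
    and "((\<lambda>\<xi>. deriv (deriv (omega \<rho> \<kappa> \<delta> \<alpha>)) \<xi>) \<longlongrightarrow> 0) (at 0)"
proof -
  let ?K = "omega_scale \<rho> \<kappa> \<delta> \<alpha>"
  let ?L = "- (sqrt (\<kappa> * (1 - \<alpha>)) * \<delta> powr (3 - \<alpha>) / (4 * (2 - \<alpha>) * sqrt \<rho>))"
  have "((\<lambda>\<xi>. ?K * \<delta> ^ 3 * (profile2 \<alpha> (\<delta> * \<bar>\<xi>\<bar>) / (\<delta> * \<bar>\<xi>\<bar>)))
      \<longlongrightarrow> ?K * \<delta> ^ 3 * (- sqrt (1 - \<alpha>) / (8 * (2 - \<alpha>)))) (at 0)"
    using assms
    by (intro tendsto_mult_left
        filterlim_compose[OF profile2_tendsto_at_0 filterlim_dilated_abs_at_0])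
  moreover have "?K * \<delta> ^ 3 * (- sqrt (1 - \<alpha>) / (8 * (2 - \<alpha>))) = ?L"
  proof -
    have "\<delta> powr (3 - \<alpha>) = \<delta> powr (- \<alpha>) * \<delta> ^ 3"
      using assms powr_add[of \<delta> "- \<alpha>" 3] by (simp add: powr_numeral)
    then show ?thesis
      unfolding omega_scale_def real_sqrt_mult real_sqrt_divide using assms
      by (simp add: field_simps)
  qed
  moreover have "\<forall>\<^sub>F \<xi> in at 0. ?K * \<delta> ^ 3 * (profile2 \<alpha> (\<delta> * \<bar>\<xi>\<bar>) / (\<delta> * \<bar>\<xi>\<bar>))
      = inverse \<bar>\<xi>\<bar> * deriv (deriv (omega \<rho> \<kappa> \<delta> \<alpha>)) \<xi>"
    using eventually_neq_at_within[of 0]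
    by eventually_elim
       (use assms in \<open>simp add: deriv_omega(2) field_simps power2_eq_square power3_eq_cube\<close>)
  ultimately show *: "((\<lambda>\<xi>. inverse \<bar>\<xi>\<bar> * deriv (deriv (omega \<rho> \<kappa> \<delta> \<alpha>)) \<xi>) \<longlongrightarrow> ?L) (at 0)"
    by (simp add: Lim_transform_eventually)
  have "((\<lambda>\<xi>. \<bar>\<xi>\<bar> * (inverse \<bar>\<xi>\<bar> * deriv (deriv (omega \<rho> \<kappa> \<delta> \<alpha>)) \<xi>)) \<longlongrightarrow> \<bar>0\<bar> * ?L) (at 0)"
    by (intro tendsto_intros *)
  moreover have "\<forall>\<^sub>F \<xi> in at 0. \<bar>\<xi>\<bar> * (inverse \<bar>\<xi>\<bar> * deriv (deriv (omega \<rho> \<kappa> \<delta> \<alpha>)) \<xi>)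
      = deriv (deriv (omega \<rho> \<kappa> \<delta> \<alpha>)) \<xi>"
    using eventually_neq_at_within[of 0] by eventually_elim simp
  ultimately show "((\<lambda>\<xi>. deriv (deriv (omega \<rho> \<kappa> \<delta> \<alpha>)) \<xi>) \<longlongrightarrow> 0) (at 0)"
    by (simp add: Lim_transform_eventually)
qed

lemma deriv2_omega_expansion_at_infinity:
  assumes "\<rho> > 0" "\<kappa> > 0" "\<delta> > 0" "0 < \<alpha>" "\<alpha> < 1"
  shows "((\<lambda>\<xi>. \<bar>\<xi>\<bar> powr (2 - \<alpha>) * deriv (deriv (omega \<rho> \<kappa> \<delta> \<alpha>)) \<xi>
        - sqrt (\<kappa> / \<rho>) * (sin (\<delta> * \<bar>\<xi>\<bar>) * (\<delta> * \<bar>\<xi>\<bar>) powr (1 - 2 * \<alpha>) / sqrt (partial_I \<alpha> (\<delta> * \<bar>\<xi>\<bar>))))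
      \<longlongrightarrow> - (2 * \<alpha> * (1 - \<alpha>) * sqrt (\<kappa> / \<rho>) * sqrt (I_const \<alpha>))) at_infinity"
proof -
  have lim: "((\<lambda>\<xi>. 2 * sqrt (\<kappa> / \<rho>) * smooth_part \<alpha> (\<delta> * \<bar>\<xi>\<bar>))
      \<longlongrightarrow> 2 * sqrt (\<kappa> / \<rho>) * (- \<alpha> * (1 - \<alpha>) * sqrt (I_const \<alpha>))) at_infinity"
    using assms
    by (intro tendsto_mult_left
        filterlim_compose[OF smooth_part_tendsto filterlim_dilated_abs_at_infinity])
  have L: "2 * sqrt (\<kappa> / \<rho>) * (- \<alpha> * (1 - \<alpha>) * sqrt (I_const \<alpha>))
      = - (2 * \<alpha> * (1 - \<alpha>) * sqrt (\<kappa> / \<rho>) * sqrt (I_const \<alpha>))"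
    by simp
  have ev: "\<forall>\<^sub>F \<xi> in at_infinity. 2 * sqrt (\<kappa> / \<rho>) * smooth_part \<alpha> (\<delta> * \<bar>\<xi>\<bar>)
      = \<bar>\<xi>\<bar> powr (2 - \<alpha>) * deriv (deriv (omega \<rho> \<kappa> \<delta> \<alpha>)) \<xi>
        - sqrt (\<kappa> / \<rho>) * (sin (\<delta> * \<bar>\<xi>\<bar>) * (\<delta> * \<bar>\<xi>\<bar>) powr (1 - 2 * \<alpha>) / sqrt (partial_I \<alpha> (\<delta> * \<bar>\<xi>\<bar>)))"
    using eventually_nonzero_at_infinity
  proof eventually_elim
    case (elim \<xi>)
    define x where "x = \<delta> * \<bar>\<xi>\<bar>"
    have x: "0 < x" using assms elim by (simp add: x_def)
    have "\<delta> powr (2 - \<alpha>) = \<delta> powr (- \<alpha>) * \<delta>\<^sup>2"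
      using assms powr_add[of \<delta> "- \<alpha>" 2] by (simp add: powr_numeral)
    then have "\<bar>\<xi>\<bar> powr (2 - \<alpha>) * deriv (deriv (omega \<rho> \<kappa> \<delta> \<alpha>)) \<xi>
        = 2 * sqrt (\<kappa> / \<rho>) * (x powr (2 - \<alpha>) * profile2 \<alpha> x)"
      using assms elim by (simp add: deriv_omega(2) omega_scale_def powr_mult x_def)
    then show ?case
      unfolding profile2_decomposition[OF assms(5) x] x_def[symmetric]
      by (simp add: algebra_simps)
  qed
  show ?thesis
    using Lim_transform_eventually[OF lim ev] unfolding L .
qed

lemma sin_over_sqrt_partial_I_bound:
  assumes "\<alpha> < 1" "1 \<le> x"
  shows "\<bar>sin x * r / sqrt (partial_I \<alpha> x)\<bar> \<le> \<bar>r\<bar> / sqrt (partial_I \<alpha> 1)"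
proof -
  have "partial_I \<alpha> 1 \<le> partial_I \<alpha> x"
    using assms by (intro partial_I_mono) auto
  moreover have "0 < partial_I \<alpha> 1"
    using partial_I_pos assms by simp
  moreover have "\<bar>sin x\<bar> * \<bar>r\<bar> \<le> \<bar>r\<bar>"
    using mult_right_mono[of "\<bar>sin x\<bar>" 1 "\<bar>r\<bar>"] by simp
  ultimately show ?thesis
    by (auto simp: abs_mult intro!: frac_le)
qed

lemma deriv2_omega_tendsto_at_infinity:
  assumes "\<rho> > 0" "\<kappa> > 0" "\<delta> > 0" "1 / 2 < \<alpha>" "\<alpha> < 1"
  shows "((\<lambda>\<xi>. \<bar>\<xi>\<bar> powr (2 - \<alpha>) * deriv (deriv (omega \<rho> \<kappa> \<delta> \<alpha>)) \<xi>)
      \<longlongrightarrow> - (2 * \<alpha> * (1 - \<alpha>) * sqrt \<kappa> / sqrt \<rho> * I_const \<alpha> powr (1 / 2))) at_infinity"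
proof -
  let ?osc = "\<lambda>x. sin x * x powr (1 - 2 * \<alpha>) / sqrt (partial_I \<alpha> x)"
  have "(?osc \<longlongrightarrow> 0) at_top"
  proof (rule Lim_null_comparison)
    show "\<forall>\<^sub>F x in at_top. norm (?osc x) \<le> x powr (1 - 2 * \<alpha>) / sqrt (partial_I \<alpha> 1)"
      using eventually_ge_at_top[of 1]
    proof eventually_elim
      case (elim x)
      show ?case
        using sin_over_sqrt_partial_I_bound[OF assms(5) elim, of "x powr (1 - 2 * \<alpha>)"] by simp
    qed
    have "((\<lambda>x. x powr (1 - 2 * \<alpha>)) \<longlongrightarrow> 0) at_top"
      using assms by real_asymp
    then show "((\<lambda>x. x powr (1 - 2 * \<alpha>) / sqrt (partial_I \<alpha> 1)) \<longlongrightarrow> 0) at_top"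
      using tendsto_mult_right_zero by (simp add: tendsto_divide_zero)
  qed
  from filterlim_compose[OF this filterlim_dilated_abs_at_infinity[OF assms(3)]]
  have osc: "((\<lambda>\<xi>. ?osc (\<delta> * \<bar>\<xi>\<bar>)) \<longlongrightarrow> 0) at_infinity" .
  have "0 < \<alpha>" using assms by simp
  from tendsto_add[OF deriv2_omega_expansion_at_infinity[OF assms(1-3) this assms(5)]
      tendsto_mult_left[OF osc, of "sqrt (\<kappa> / \<rho>)"]]
  show ?thesis
    using I_const_pos[OF \<open>0 < \<alpha>\<close> assms(5)] by (simp add: powr_half_sqrt real_sqrt_divide)
qed

text \<open>Multiplying \<open>deriv2_omega_expansion_at_infinity\<close> by \<open>\<bar>\<xi>\<bar> powr (2 * \<alpha> - 1)\<close> gives the oscillation a bounded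
  amplitude. The factor is \<open>1\<close> for \<open>\<alpha> = 1 / 2\<close> and tends to \<open>0\<close> for \<open>\<alpha> < 1 / 2\<close>, which decides whether
  the convergent part survives. In the oscillating term, the partial integral may be replaced by its
  limit \<open>I_const \<alpha>\<close> at the cost of \<open>?R\<close>, a bounded function times a null function.\<close>

lemma deriv2_omega_oscillation_at_infinity:
  assumes "\<rho> > 0" "\<kappa> > 0" "\<delta> > 0" "0 < \<alpha>" "\<alpha> \<le> 1 / 2"
  shows "((\<lambda>\<xi>. \<bar>\<xi>\<bar> powr (1 + \<alpha>) * deriv (deriv (omega \<rho> \<kappa> \<delta> \<alpha>)) \<xi>
        - sqrt \<kappa> * \<delta> powr (1 - 2 * \<alpha>) / sqrt \<rho> * I_const \<alpha> powr (- 1 / 2) * sin (\<delta> * \<bar>\<xi>\<bar>))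
      \<longlongrightarrow> (if \<alpha> = 1 / 2 then - (1 / 2 * (\<kappa> / \<rho> * I_const (1 / 2)) powr (1 / 2)) else 0)) at_infinity"
    (is "(?f \<longlongrightarrow> ?b) _")
proof -
  have "\<alpha> < 1" using assms by simp
  note I = I_const_pos[OF assms(4) this]
  define B where "B = - (2 * \<alpha> * (1 - \<alpha>) * sqrt (\<kappa> / \<rho>) * sqrt (I_const \<alpha>))"
  let ?E = "\<lambda>\<xi>. \<bar>\<xi>\<bar> powr (2 - \<alpha>) * deriv (deriv (omega \<rho> \<kappa> \<delta> \<alpha>)) \<xi>
        - sqrt (\<kappa> / \<rho>) * (sin (\<delta> * \<bar>\<xi>\<bar>) * (\<delta> * \<bar>\<xi>\<bar>) powr (1 - 2 * \<alpha>) / sqrt (partial_I \<alpha> (\<delta> * \<bar>\<xi>\<bar>)))"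
  let ?R = "\<lambda>\<xi>. sin (\<delta> * \<bar>\<xi>\<bar>) * (1 / sqrt (partial_I \<alpha> (\<delta> * \<bar>\<xi>\<bar>)) - 1 / sqrt (I_const \<alpha>))"
  have p: "((\<lambda>\<xi>::real. \<bar>\<xi>\<bar> powr (2 * \<alpha> - 1)) \<longlongrightarrow> (if \<alpha> = 1 / 2 then 1 else 0)) at_infinity"
  proof (cases "\<alpha> = 1 / 2")
    case True
    have "\<forall>\<^sub>F \<xi> in at_infinity. 1 = \<bar>\<xi>::real\<bar> powr (2 * \<alpha> - 1)"
      using eventually_nonzero_at_infinity by eventually_elim (simp add: True)
    with True show ?thesis
      by (auto intro: Lim_transform_eventually[OF tendsto_const])
  next
    case False
    with assms have "((\<lambda>x::real. x powr (2 * \<alpha> - 1)) \<longlongrightarrow> 0) at_top"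
      by real_asymp
    from filterlim_compose[OF this filterlim_dilated_abs_at_infinity[of 1]] False
    show ?thesis by simp
  qed
  have q: "(?R \<longlongrightarrow> 0) at_infinity"
  proof (rule Lim_null_comparison)
    let ?g = "\<lambda>x. \<bar>1 / sqrt (partial_I \<alpha> x) - 1 / sqrt (I_const \<alpha>)\<bar>"
    show "\<forall>\<^sub>F \<xi> in at_infinity. norm (?R \<xi>) \<le> ?g (\<delta> * \<bar>\<xi>\<bar>)"
      by (intro always_eventually allI) (auto simp: abs_mult intro!: mult_left_le_one_le)
    have "(?g \<longlongrightarrow> \<bar>1 / sqrt (I_const \<alpha>) - 1 / sqrt (I_const \<alpha>)\<bar>) at_top"
      using I assms by (intro tendsto_intros partial_I_tendsto) auto
    from filterlim_compose[OF this filterlim_dilated_abs_at_infinity[OF assms(3)]]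
    show "((\<lambda>\<xi>. ?g (\<delta> * \<bar>\<xi>\<bar>)) \<longlongrightarrow> 0) at_infinity" by simp
  qed
  have "((\<lambda>\<xi>. \<bar>\<xi>\<bar> powr (2 * \<alpha> - 1) * ?E \<xi> + sqrt (\<kappa> / \<rho>) * \<delta> powr (1 - 2 * \<alpha>) * ?R \<xi>)
      \<longlongrightarrow> (if \<alpha> = 1 / 2 then 1 else 0) * B + sqrt (\<kappa> / \<rho>) * \<delta> powr (1 - 2 * \<alpha>) * 0) at_infinity"
    unfolding B_def
    by (intro tendsto_add tendsto_mult[OF p] tendsto_mult_left[OF q]
        deriv2_omega_expansion_at_infinity assms \<open>\<alpha> < 1\<close>)
  moreover have "(if \<alpha> = 1 / 2 then 1 else 0) * B + sqrt (\<kappa> / \<rho>) * \<delta> powr (1 - 2 * \<alpha>) * 0 = ?b"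
  proof (cases "\<alpha> = 1 / 2")
    case True
    have "0 < I_const (1 / 2)"
      using I unfolding True .
    then have "(\<kappa> / \<rho> * I_const (1 / 2)) powr (1 / 2) = sqrt (\<kappa> / \<rho>) * sqrt (I_const (1 / 2))"
      unfolding real_sqrt_mult[symmetric] using assms by (intro powr_half_sqrt) auto
    then show ?thesis by (simp add: B_def True)
  qed simp
  moreover have "\<forall>\<^sub>F \<xi> in at_infinity.
      \<bar>\<xi>\<bar> powr (2 * \<alpha> - 1) * ?E \<xi> + sqrt (\<kappa> / \<rho>) * \<delta> powr (1 - 2 * \<alpha>) * ?R \<xi> = ?f \<xi>"
    using eventually_nonzero_at_infinity
  proof eventually_elim
    case (elim \<xi>)
    define D where "D = deriv (deriv (omega \<rho> \<kappa> \<delta> \<alpha>)) \<xi>"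
    define q where "q = sqrt (partial_I \<alpha> (\<delta> * \<bar>\<xi>\<bar>))"
    have a: "\<bar>\<xi>\<bar> powr (2 * \<alpha> - 1) * \<bar>\<xi>\<bar> powr (2 - \<alpha>) = \<bar>\<xi>\<bar> powr (1 + \<alpha>)"
      by (simp flip: powr_add)
    have b: "\<bar>\<xi>\<bar> powr (2 * \<alpha> - 1) * (\<delta> * \<bar>\<xi>\<bar>) powr (1 - 2 * \<alpha>) = \<delta> powr (1 - 2 * \<alpha>)"
    proof -
      have "\<bar>\<xi>\<bar> powr (2 * \<alpha> - 1) * \<bar>\<xi>\<bar> powr (1 - 2 * \<alpha>) = 1"
        using elim by (simp flip: powr_add)
      then show ?thesis using assms by (simp add: powr_mult)
    qed
    have c: "I_const \<alpha> powr (- 1 / 2) = 1 / sqrt (I_const \<alpha>)"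
      using I powr_minus_divide[of "I_const \<alpha>" "1 / 2"] by (simp add: powr_half_sqrt)
    have "\<bar>\<xi>\<bar> powr (2 * \<alpha> - 1) * ?E \<xi>
        = (\<bar>\<xi>\<bar> powr (2 * \<alpha> - 1) * \<bar>\<xi>\<bar> powr (2 - \<alpha>)) * D
          - sqrt (\<kappa> / \<rho>) * (sin (\<delta> * \<bar>\<xi>\<bar>) * (\<bar>\<xi>\<bar> powr (2 * \<alpha> - 1) * (\<delta> * \<bar>\<xi>\<bar>) powr (1 - 2 * \<alpha>)) / q)"
      unfolding D_def[symmetric] q_def[symmetric] by (simp add: algebra_simps)
    then show ?case
      unfolding a b c D_def[symmetric] q_def[symmetric] real_sqrt_divide by (simp add: algebra_simps)
  qed
  ultimately show ?thesis
    by (simp add: Lim_transform_eventually)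
qed

theorem theorem2p3:
  fixes \<rho> \<kappa> \<delta> \<alpha> :: real
  assumes "\<rho> > 0" and "\<kappa> > 0" and "\<delta> > 0" and "0 < \<alpha>" and "\<alpha> < 1"
  shows "(\<forall>\<xi>. \<xi> \<noteq> 0 \<longrightarrow> (omega \<rho> \<kappa> \<delta> \<alpha>) differentiable (at \<xi>) \<and> deriv (omega \<rho> \<kappa> \<delta> \<alpha>) differentiable (at \<xi>)) \<and>
    ((\<lambda>\<xi>. deriv (omega \<rho> \<kappa> \<delta> \<alpha>) \<xi>) \<longlongrightarrow> sqrt \<kappa> * \<delta> powr (1 - \<alpha>) / sqrt ((1 - \<alpha>) * \<rho>)) (at_right 0) \<and>
    ((\<lambda>\<xi>. deriv (omega \<rho> \<kappa> \<delta> \<alpha>) \<xi>) \<longlongrightarrow> - (sqrt \<kappa> * \<delta> powr (1 - \<alpha>) / sqrt ((1 - \<alpha>) * \<rho>))) (at_left 0) \<and>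
    ((\<lambda>\<xi>. \<bar>\<xi>\<bar> powr (1 - \<alpha>) * deriv (omega \<rho> \<kappa> \<delta> \<alpha>) \<xi>) \<longlongrightarrow> 2 * \<alpha> * sqrt (\<kappa> / \<rho> * I_const \<alpha>)) at_top \<and>
    ((\<lambda>\<xi>. \<bar>\<xi>\<bar> powr (1 - \<alpha>) * deriv (omega \<rho> \<kappa> \<delta> \<alpha>) \<xi>) \<longlongrightarrow> - (2 * \<alpha> * sqrt (\<kappa> / \<rho> * I_const \<alpha>))) at_bot \<and>
    ((\<lambda>\<xi>. inverse \<bar>\<xi>\<bar> * deriv (deriv (omega \<rho> \<kappa> \<delta> \<alpha>)) \<xi>) \<longlongrightarrow> - (sqrt (\<kappa> * (1 - \<alpha>)) * \<delta> powr (3 - \<alpha>) / (4 * (2 - \<alpha>) * sqrt \<rho>))) (at_right 0) \<and>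
    ((\<lambda>\<xi>. inverse \<bar>\<xi>\<bar> * deriv (deriv (omega \<rho> \<kappa> \<delta> \<alpha>)) \<xi>) \<longlongrightarrow> - (sqrt (\<kappa> * (1 - \<alpha>)) * \<delta> powr (3 - \<alpha>) / (4 * (2 - \<alpha>) * sqrt \<rho>))) (at_left 0) \<and>
    ((\<lambda>\<xi>. deriv (deriv (omega \<rho> \<kappa> \<delta> \<alpha>)) \<xi>) \<longlongrightarrow> 0) (at_right 0) \<and>
    ((\<lambda>\<xi>. deriv (deriv (omega \<rho> \<kappa> \<delta> \<alpha>)) \<xi>) \<longlongrightarrow> 0) (at_left 0) \<and>
    (1 / 2 < \<alpha> \<longrightarrow>
      ((\<lambda>\<xi>. \<bar>\<xi>\<bar> powr (2 - \<alpha>) * deriv (deriv (omega \<rho> \<kappa> \<delta> \<alpha>)) \<xi>) \<longlongrightarrow> - (2 * \<alpha> * (1 - \<alpha>) * sqrt \<kappa> / sqrt \<rho> * I_const \<alpha> powr (1 / 2))) at_top \<and>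
      ((\<lambda>\<xi>. \<bar>\<xi>\<bar> powr (2 - \<alpha>) * deriv (deriv (omega \<rho> \<kappa> \<delta> \<alpha>)) \<xi>) \<longlongrightarrow> - (2 * \<alpha> * (1 - \<alpha>) * sqrt \<kappa> / sqrt \<rho> * I_const \<alpha> powr (1 / 2))) at_bot) \<and>
    (\<alpha> < 1 / 2 \<longrightarrow>
      Liminf at_top (\<lambda>\<xi>. ereal (\<bar>\<xi>\<bar> powr (1 + \<alpha>) * deriv (deriv (omega \<rho> \<kappa> \<delta> \<alpha>)) \<xi>)) = ereal (- (sqrt \<kappa> * \<delta> powr (1 - 2 * \<alpha>) / sqrt \<rho> * I_const \<alpha> powr (- 1 / 2))) \<and>
      Limsup at_top (\<lambda>\<xi>. ereal (\<bar>\<xi>\<bar> powr (1 + \<alpha>) * deriv (deriv (omega \<rho> \<kappa> \<delta> \<alpha>)) \<xi>)) = ereal (sqrt \<kappa> * \<delta> powr (1 - 2 * \<alpha>) / sqrt \<rho> * I_const \<alpha> powr (- 1 / 2)) \<and>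
      Liminf at_bot (\<lambda>\<xi>. ereal (\<bar>\<xi>\<bar> powr (1 + \<alpha>) * deriv (deriv (omega \<rho> \<kappa> \<delta> \<alpha>)) \<xi>)) = ereal (- (sqrt \<kappa> * \<delta> powr (1 - 2 * \<alpha>) / sqrt \<rho> * I_const \<alpha> powr (- 1 / 2))) \<and>
      Limsup at_bot (\<lambda>\<xi>. ereal (\<bar>\<xi>\<bar> powr (1 + \<alpha>) * deriv (deriv (omega \<rho> \<kappa> \<delta> \<alpha>)) \<xi>)) = ereal (sqrt \<kappa> * \<delta> powr (1 - 2 * \<alpha>) / sqrt \<rho> * I_const \<alpha> powr (- 1 / 2)) \<and>
      - (sqrt \<kappa> * \<delta> powr (1 - 2 * \<alpha>) / sqrt \<rho> * I_const \<alpha> powr (- 1 / 2)) < sqrt \<kappa> * \<delta> powr (1 - 2 * \<alpha>) / sqrt \<rho> * I_const \<alpha> powr (- 1 / 2)) \<and>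
    (\<alpha> = 1 / 2 \<longrightarrow>
      Liminf at_top (\<lambda>\<xi>. ereal (\<bar>\<xi>\<bar> powr (3 / 2) * deriv (deriv (omega \<rho> \<kappa> \<delta> \<alpha>)) \<xi>)) = ereal (- (sqrt \<kappa> / sqrt \<rho> * I_const (1 / 2) powr (- 1 / 2)) - 1 / 2 * (\<kappa> / \<rho> * I_const (1 / 2)) powr (1 / 2)) \<and>
      Limsup at_top (\<lambda>\<xi>. ereal (\<bar>\<xi>\<bar> powr (3 / 2) * deriv (deriv (omega \<rho> \<kappa> \<delta> \<alpha>)) \<xi>)) = ereal (sqrt \<kappa> / sqrt \<rho> * I_const (1 / 2) powr (- 1 / 2) - 1 / 2 * (\<kappa> / \<rho> * I_const (1 / 2)) powr (1 / 2)) \<and>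
      Liminf at_bot (\<lambda>\<xi>. ereal (\<bar>\<xi>\<bar> powr (3 / 2) * deriv (deriv (omega \<rho> \<kappa> \<delta> \<alpha>)) \<xi>)) = ereal (- (sqrt \<kappa> / sqrt \<rho> * I_const (1 / 2) powr (- 1 / 2)) - 1 / 2 * (\<kappa> / \<rho> * I_const (1 / 2)) powr (1 / 2)) \<and>
      Limsup at_bot (\<lambda>\<xi>. ereal (\<bar>\<xi>\<bar> powr (3 / 2) * deriv (deriv (omega \<rho> \<kappa> \<delta> \<alpha>)) \<xi>)) = ereal (sqrt \<kappa> / sqrt \<rho> * I_const (1 / 2) powr (- 1 / 2) - 1 / 2 * (\<kappa> / \<rho> * I_const (1 / 2)) powr (1 / 2)) \<and>
      - (sqrt \<kappa> / sqrt \<rho> * I_const (1 / 2) powr (- 1 / 2)) - 1 / 2 * (\<kappa> / \<rho> * I_const (1 / 2)) powr (1 / 2) < sqrt \<kappa> / sqrt \<rho> * I_const (1 / 2) powr (- 1 / 2) - 1 / 2 * (\<kappa> / \<rho> * I_const (1 / 2)) powr (1 / 2))"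
proof -
  let ?w = "omega \<rho> \<kappa> \<delta> \<alpha>"
  have diff: "?w differentiable (at \<xi>) \<and> deriv ?w differentiable (at \<xi>)" if "\<xi> \<noteq> 0" for \<xi>
    using omega_has_derivative[OF assms(1-3,5) that] deriv_omega_has_derivative[OF assms(1-3,5) that]
    by (auto simp: real_differentiable_def)
  have right: "(f \<longlongrightarrow> L) (at_right 0)" and left: "(f \<longlongrightarrow> L) (at_left 0)"
    if "(f \<longlongrightarrow> L) (at 0)" for f :: "real \<Rightarrow> real" and L
    using that by (auto intro: tendsto_within_subset)
  have top: "(f \<longlongrightarrow> L) at_top" and bot: "(f \<longlongrightarrow> L) at_bot"
    if "(f \<longlongrightarrow> L) at_infinity" for f :: "real \<Rightarrow> real" and L
    using that filterlim_mono[OF _ order_refl at_top_le_at_infinity]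
      filterlim_mono[OF _ order_refl at_bot_le_at_infinity] by blast+
  have sgn_pos: "(f \<longlongrightarrow> L) F"
    if "((\<lambda>x. sgn x * f x) \<longlongrightarrow> L) F" "\<forall>\<^sub>F x in F. 0 < x" for f :: "real \<Rightarrow> real" and L F
    by (rule Lim_transform_eventually[OF that(1)]) (use that(2) in \<open>eventually_elim, simp\<close>)
  have sgn_neg: "(f \<longlongrightarrow> - L) F"
    if "((\<lambda>x. sgn x * f x) \<longlongrightarrow> L) F" "\<forall>\<^sub>F x in F. x < 0" for f :: "real \<Rightarrow> real" and L F
    by (rule Lim_transform_eventually[OF tendsto_minus[OF that(1)]])
       (use that(2) in \<open>eventually_elim, simp\<close>)
  have neg: "\<forall>\<^sub>F x in at_left 0. x < (0::real)"
    by (simp add: eventually_at_filter)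
  note at0 = deriv_omega_tendsto_at_0[OF assms]
    and at_inf = deriv_omega_tendsto_at_infinity[OF assms]
    and at0' = deriv2_omega_tendsto_at_0[OF assms]
  let ?C = "sqrt \<kappa> * \<delta> powr (1 - 2 * \<alpha>) / sqrt \<rho> * I_const \<alpha> powr (- 1 / 2)"
  have C: "0 < ?C"
    using assms I_const_pos[OF assms(4,5)] by simp
  have osc: "((\<lambda>\<xi>. \<bar>\<xi>\<bar> powr (1 + \<alpha>) * deriv (deriv ?w) \<xi> - ?C * sin (\<delta> * \<bar>\<xi>\<bar>))
      \<longlongrightarrow> (if \<alpha> = 1 / 2 then - (1 / 2 * (\<kappa> / \<rho> * I_const (1 / 2)) powr (1 / 2)) else 0)) at_infinity"
    if "\<alpha> \<le> 1 / 2"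
    by (rule deriv2_omega_oscillation_at_infinity[OF assms(1-4) that])
  note LL = Liminf_Limsup_sin_abs_perturbation[OF assms(3) less_imp_le[OF C] osc]
  show ?thesis
  proof (intro conjI impI allI)
    assume "\<alpha> < 1 / 2"
    then have le: "\<alpha> \<le> 1 / 2" and ne: "\<alpha> \<noteq> 1 / 2" by auto
    show "Liminf at_top (\<lambda>\<xi>. ereal (\<bar>\<xi>\<bar> powr (1 + \<alpha>) * deriv (deriv ?w) \<xi>)) = ereal (- ?C)"
      "Limsup at_top (\<lambda>\<xi>. ereal (\<bar>\<xi>\<bar> powr (1 + \<alpha>) * deriv (deriv ?w) \<xi>)) = ereal ?C"
      "Liminf at_bot (\<lambda>\<xi>. ereal (\<bar>\<xi>\<bar> powr (1 + \<alpha>) * deriv (deriv ?w) \<xi>)) = ereal (- ?C)"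
      "Limsup at_bot (\<lambda>\<xi>. ereal (\<bar>\<xi>\<bar> powr (1 + \<alpha>) * deriv (deriv ?w) \<xi>)) = ereal ?C"
      using LL[OF le] ne by simp_all
    show "- ?C < ?C" using C by linarith
  next
    assume half: "\<alpha> = 1 / 2"
    then have le: "\<alpha> \<le> 1 / 2" by simp
    let ?c = "sqrt \<kappa> / sqrt \<rho> * I_const (1 / 2) powr (- 1 / 2)"
    let ?b = "1 / 2 * (\<kappa> / \<rho> * I_const (1 / 2)) powr (1 / 2)"
    have c: "?C = ?c" and e: "1 + \<alpha> = 3 / 2"
      unfolding half using assms(3) by simp_all
    have lo: "- ?b - ?c = - ?c - ?b" and hi: "- ?b + ?c = ?c - ?b"
      by linarith+
    show "Liminf at_top (\<lambda>\<xi>. ereal (\<bar>\<xi>\<bar> powr (3 / 2) * deriv (deriv ?w) \<xi>)) = ereal (- ?c - ?b)"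
      "Limsup at_top (\<lambda>\<xi>. ereal (\<bar>\<xi>\<bar> powr (3 / 2) * deriv (deriv ?w) \<xi>)) = ereal (?c - ?b)"
      "Liminf at_bot (\<lambda>\<xi>. ereal (\<bar>\<xi>\<bar> powr (3 / 2) * deriv (deriv ?w) \<xi>)) = ereal (- ?c - ?b)"
      "Limsup at_bot (\<lambda>\<xi>. ereal (\<bar>\<xi>\<bar> powr (3 / 2) * deriv (deriv ?w) \<xi>)) = ereal (?c - ?b)"
      using LL[OF le] unfolding c e if_P[OF half] lo hi by blast+
    show "- ?c - ?b < ?c - ?b" using C unfolding c by linarith
  next
    assume half: "1 / 2 < \<alpha>"
    note lim = deriv2_omega_tendsto_at_infinity[OF assms(1-3) half assms(5)]
    show "((\<lambda>\<xi>. \<bar>\<xi>\<bar> powr (2 - \<alpha>) * deriv (deriv ?w) \<xi>)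
        \<longlongrightarrow> - (2 * \<alpha> * (1 - \<alpha>) * sqrt \<kappa> / sqrt \<rho> * I_const \<alpha> powr (1 / 2))) at_top"
      by (rule top[OF lim])
    show "((\<lambda>\<xi>. \<bar>\<xi>\<bar> powr (2 - \<alpha>) * deriv (deriv ?w) \<xi>)
        \<longlongrightarrow> - (2 * \<alpha> * (1 - \<alpha>) * sqrt \<kappa> / sqrt \<rho> * I_const \<alpha> powr (1 / 2))) at_bot"
      by (rule bot[OF lim])
  qed (use diff in blast, use diff in blast,
      rule sgn_pos[OF right[OF at0] eventually_at_right_less],
      rule sgn_neg[OF left[OF at0] neg],
      rule sgn_pos[OF top[OF at_inf] eventually_gt_at_top],
      rule sgn_neg[OF bot[OF at_inf] eventually_gt_at_bot],
      rule right[OF at0'(1)], rule left[OF at0'(1)], rule right[OF at0'(2)], rule left[OF at0'(2)])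
qed

end
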